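(* Let $P_{th}=\alpha\sum_{m=1}^M\eta_mP_m$, and consider the case in which the power constraint (a) of the linear program (LP) of the context is tight with $p_{max}<P_{th}$, i.e. $\bar P=p_{max}<P_{th}$. Then the optimal solution $\{y^*_{i,m}\}$ to (LP) has a threshold structure. That is, there exists a threshold $i_m^*$ on the data queue length associated with each channel state $m\in\mathcal M$ such that $0=i_1^*\le\cdots\le i_M^*$ and the optimal solution takes the form $$y^*_{i,m}=\begin{cases}0,& i<i^*_m-1,\\ \sum_{n=1}^M\eta_ny^*_{i,n}+\xi\sum_{n=1}^M\eta_ny^*_{i+1,n},& i\ge i^*_m.\end{cases}$$ Moreover, there is at most one $\tilde m\in\{2,\dots,M\}$ such that $y^*_{i^*_{\tilde m}-1,\tilde m}>0$ may hold, and $y^*_{i^*_m-1,m}=0$ for $m\in\{2,\dots,M\}\setminus\{\tilde m\}$.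
   Context: Data: a positive integer $M$ (number of channel states), $\mathcal M=\{1,\dots,M\}$; $\alpha\in(0,1)$ (probability that a packet arrives in a slot); $\xi=\frac{1-\alpha}{\alpha}$; channel state probabilities $\eta_1,\dots,\eta_M$ with $\sum_{m}\eta_m=1$; transmission powers $P_1\le P_2\le\cdots\le P_M$, where $P_m$ is the power used to send one packet in channel state $m$; buffer capacity $Q$, a positive integer or $\infty$; $\mathcal Q=\{0,1,\dots,Q\}$ (all nonnegative integers if $Q=\infty$), the set of queue lengths; and a maximum average power $p_{max}$. The linear program (LP), in the variables $\{y_{i,m}\}_{i\in\mathcal Q,m\in\mathcal M}$, is: minimize the average delay $$\bar D=\frac1\alpha\sum_{i=0}^{Q}\sum_{m=1}^{M}i\,\eta_my_{i,m}$$ subject to (a) $\bar P=\alpha\sum_{i=0}^{Q}\sum_{m=1}^{M}\eta_mP_my_{i,m}\le p_{max}$; (b) $\sum_{i=0}^{Q}\sum_{m=1}^{M}\eta_my_{i,m}=1$; (c) $0\le y_{i,m}\le\sum_{n=1}^M\eta_ny_{i,n}+\xi\sum_{n=1}^M\eta_ny_{i+1,n}$ for all $i\in\mathcal Q$, $m\in\mathcal M$. Here $y_{i,m}$ is read as $0$ for $i$ outside $\mathcal Q$. It is assumed throughout that no buffer overflow occurs, i.e. if $Q<\infty$ the stationary probability $\sum_m\eta_my_{Q,m}$ of a full buffer is $0$. The optimal solution of (LP) is denoted $\{y^*_{i,m}\}$.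
   Formalization: As optimal solutions need not be unique and some lack the stated form (e.g. with equal powers), it is shown that some optimal solution has it; for Q=∞ thresholds may be infinite, but only if p_max is the least attainable average power, where finite thresholds are impossible. *)

theory Defs
  imports "HOL-Analysis.Analysis" "HOL-Library.Extended_Nat"
begin

(* Channel states are the naturals 1, ..., M.  The buffer capacity is an extended natural, so that
   the cases of a finite and of an infinite buffer are treated together. *)

definition queue_lengths :: "enat \<Rightarrow> nat set" where
  "queue_lengths Q = {i. enat i \<le> Q}"

definition xi :: "real \<Rightarrow> real" where
  "xi \<alpha> = (1 - \<alpha>) / \<alpha>"

definition queue_prob :: "nat \<Rightarrow> (nat \<Rightarrow> real) \<Rightarrow> (nat \<Rightarrow> nat \<Rightarrow> real) \<Rightarrow> nat \<Rightarrow> real" where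
  "queue_prob M \<eta> y i = (\<Sum>m = 1..M. \<eta> m * y i m)"

definition upper_bound ::
  "nat \<Rightarrow> real \<Rightarrow> (nat \<Rightarrow> real) \<Rightarrow> (nat \<Rightarrow> nat \<Rightarrow> real) \<Rightarrow> nat \<Rightarrow> real" where
  "upper_bound M \<alpha> \<eta> y i = queue_prob M \<eta> y i + xi \<alpha> * queue_prob M \<eta> y (i + 1)"

(* Valued in ennreal because for an infinite buffer the series may diverge; the summands are
   nonnegative at every feasible point. *)
definition avg_delay ::
  "nat \<Rightarrow> real \<Rightarrow> (nat \<Rightarrow> real) \<Rightarrow> enat \<Rightarrow> (nat \<Rightarrow> nat \<Rightarrow> real) \<Rightarrow> ennreal" where
  "avg_delay M \<alpha> \<eta> Q y =
     ennreal (1 / \<alpha>) * (\<Sum>\<^sub>\<infinity>i\<in>queue_lengths Q. ennreal (\<Sum>m = 1..M. real i * \<eta> m * y i m))"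

(* At every feasible point the series converges absolutely, being dominated by the series of
   queue_prob times the maximum of the moduli of P 1, ..., P M. *)
definition avg_power ::
  "nat \<Rightarrow> real \<Rightarrow> (nat \<Rightarrow> real) \<Rightarrow> (nat \<Rightarrow> real) \<Rightarrow> enat \<Rightarrow> (nat \<Rightarrow> nat \<Rightarrow> real) \<Rightarrow> real" where
  "avg_power M \<alpha> \<eta> P Q y =
     \<alpha> * (\<Sum>\<^sub>\<infinity>i\<in>queue_lengths Q. \<Sum>m = 1..M. \<eta> m * P m * y i m)"

(* The fourth conjunct is the convention y i m = 0 for i outside the set of queue lengths; the last
   one says that a finite buffer does not overflow. *)
definition lp_feasible ::
  "nat \<Rightarrow> real \<Rightarrow> (nat \<Rightarrow> real) \<Rightarrow> (nat \<Rightarrow> real) \<Rightarrow> enat \<Rightarrow> real \<Rightarrow> (nat \<Rightarrow> nat \<Rightarrow> real) \<Rightarrow> bool" where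
  "lp_feasible M \<alpha> \<eta> P Q pmax y \<longleftrightarrow>
     avg_power M \<alpha> \<eta> P Q y \<le> pmax \<and>
     ((\<lambda>i. \<Sum>m = 1..M. \<eta> m * y i m) has_sum 1) (queue_lengths Q) \<and>
     (\<forall>i\<in>queue_lengths Q. \<forall>m\<in>{1..M}. 0 \<le> y i m \<and> y i m \<le> upper_bound M \<alpha> \<eta> y i) \<and>
     (\<forall>i. i \<notin> queue_lengths Q \<longrightarrow> (\<forall>m\<in>{1..M}. y i m = 0)) \<and>
     (\<forall>q. Q = enat q \<longrightarrow> queue_prob M \<eta> y q = 0)"

definition lp_optimal ::
  "nat \<Rightarrow> real \<Rightarrow> (nat \<Rightarrow> real) \<Rightarrow> (nat \<Rightarrow> real) \<Rightarrow> enat \<Rightarrow> real \<Rightarrow> (nat \<Rightarrow> nat \<Rightarrow> real) \<Rightarrow> bool" where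
  "lp_optimal M \<alpha> \<eta> P Q pmax y \<longleftrightarrow>
     lp_feasible M \<alpha> \<eta> P Q pmax y \<and>
     (\<forall>z. lp_feasible M \<alpha> \<eta> P Q pmax z \<longrightarrow> avg_delay M \<alpha> \<eta> Q y \<le> avg_delay M \<alpha> \<eta> Q z)"

definition power_threshold :: "nat \<Rightarrow> real \<Rightarrow> (nat \<Rightarrow> real) \<Rightarrow> (nat \<Rightarrow> real) \<Rightarrow> real" where
  "power_threshold M \<alpha> \<eta> P = \<alpha> * (\<Sum>m = 1..M. \<eta> m * P m)"

(* A threshold may be infinite, meaning that the channel state is never used.  The inequality
   i < thr m - 1 is written i + 1 < thr m, and i = thr m - 1 is written thr m = i + 1, since
   subtraction on enat is truncated at 0. *)
definition threshold_structure ::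
  "nat \<Rightarrow> real \<Rightarrow> (nat \<Rightarrow> real) \<Rightarrow> enat \<Rightarrow> (nat \<Rightarrow> enat) \<Rightarrow> (nat \<Rightarrow> nat \<Rightarrow> real) \<Rightarrow> bool" where
  "threshold_structure M \<alpha> \<eta> Q thr y \<longleftrightarrow>
     thr 1 = 0 \<and> mono_on {1..M} thr \<and> (\<forall>m\<in>{1..M}. thr m \<le> Q) \<and>
     (\<forall>i\<in>queue_lengths Q. \<forall>m\<in>{1..M}.
        (enat (i + 1) < thr m \<longrightarrow> y i m = 0) \<and>
        (thr m \<le> enat i \<longrightarrow> y i m = upper_bound M \<alpha> \<eta> y i)) \<and>
     (\<exists>mt\<in>{2..M}. \<forall>m\<in>{2..M} - {mt}. \<forall>i. thr m = enat (i + 1) \<longrightarrow> y i m = 0)"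

end

theory Submission
  imports Defs
begin

text \<open>
  Let \<open>D\<close> be the mean queue length and \<open>E\<close> the mean transmission energy of a stationary distribution.
  The pairs \<open>(E, D)\<close> of admissible points form a convex set, so an optimal point minimises
  \<open>E + \<kappa> D\<close> for some \<open>\<kappa> \<ge> 0\<close>, with \<open>\<kappa> > 0\<close> if some admissible point needs less power.
  Let \<open>v\<close> be the minimum.  Dual variables are found by the forward recursion
  \<open>c\<^sub>i - F(c\<^sub>i) = v - \<kappa> i + \<xi> F(c\<^sub>i\<^sub>-\<^sub>1)\<close>, where \<open>F(c) = \<Sum>\<^sub>m \<eta>\<^sub>m max(0, c - P\<^sub>m)\<close>: if a step of the recursion had no
  solution, a threshold policy would have a Lagrangian value below \<open>v\<close>.  Complementary slackness says that
  channel \<open>m\<close> is used at queue length \<open>i\<close> if \<open>c\<^sub>i > P\<^sub>m\<close> and not used if \<open>c\<^sub>i < P\<^sub>m\<close>.  It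
  makes the support of the optimum bounded, with the recursion reaching its largest admissible value at the last
  level, and this forces \<open>c\<close> to be strictly increasing.  Hence each channel is undecided at one queue length
  at most, and deciding the channels one after the other gives a chain of deterministic threshold policies
  which all have the value \<open>v\<close>.  Likelihood ratios show that \<open>D\<close> of the optimum lies between the values of \<open>D\<close>
  at the ends of the chain, so it is attained on a segment between two neighbours, whose thresholds differ by one
  in one channel.

  For an infinite buffer and minimal power there need not be a multiplier.  In that case inserting one more level
  that is served by a cheapest channel shows that only cheapest channels are used, and the policy which always uses
  all of them is optimal.
\<close>

subsection \<open>Feasible points without the power constraint\<close>

locale queue_model =
  fixes M :: nat and \<alpha> :: real and \<eta> P :: "nat \<Rightarrow> real" and Q :: enat
  assumes M_pos: "M \<ge> 1" and alpha: "0 < \<alpha>" "\<alpha> < 1"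
    and eta_nonneg: "\<And>m. m \<in> {1..M} \<Longrightarrow> 0 \<le> \<eta> m"
    and eta_sum: "(\<Sum>m = 1..M. \<eta> m) = 1"
    and P_mono: "mono_on {1..M} P" and Q_pos: "Q > 0"
begin

abbreviation "\<xi> \<equiv> xi \<alpha>"
abbreviation "qp \<equiv> queue_prob M \<eta>"
abbreviation "ub \<equiv> upper_bound M \<alpha> \<eta>"

definition energy :: "(nat \<Rightarrow> nat \<Rightarrow> real) \<Rightarrow> nat \<Rightarrow> real" where
  "energy y i = (\<Sum>m = 1..M. \<eta> m * P m * y i m)"

definition total_energy :: "(nat \<Rightarrow> nat \<Rightarrow> real) \<Rightarrow> real" where
  "total_energy y = (\<Sum>i. energy y i)"

definition mean_queue :: "(nat \<Rightarrow> nat \<Rightarrow> real) \<Rightarrow> real" where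
  "mean_queue y = (\<Sum>i. real i * qp y i)"

definition finite_mean :: "(nat \<Rightarrow> nat \<Rightarrow> real) \<Rightarrow> bool" where
  "finite_mean y \<longleftrightarrow> summable (\<lambda>i. real i * qp y i)"

text \<open>
  Feasibility without the power constraint.  The absence of overflow makes the constraints force \<open>y\<close> to vanish
  also at the level \<open>Q\<close> itself, hence \<open>Q \<le> enat i\<close>.
\<close>

definition admissible :: "(nat \<Rightarrow> nat \<Rightarrow> real) \<Rightarrow> bool" where
  "admissible y \<longleftrightarrow>
     (\<forall>i. \<forall>m\<in>{1..M}. 0 \<le> y i m \<and> y i m \<le> ub y i) \<and> qp y sums 1 \<and>
     (\<forall>i. Q \<le> enat i \<longrightarrow> (\<forall>m\<in>{1..M}. y i m = 0))"

definition mean_P :: real where "mean_P = (\<Sum>m = 1..M. \<eta> m * P m)"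

lemma xi_pos: "\<xi> > 0"
  using alpha by (simp add: xi_def)

lemma qp_nonneg: "(\<And>m. m \<in> {1..M} \<Longrightarrow> 0 \<le> y i m) \<Longrightarrow> 0 \<le> qp y i"
  unfolding queue_prob_def by (intro sum_nonneg mult_nonneg_nonneg eta_nonneg) auto

lemma qp_eq_0: "(\<And>m. m \<in> {1..M} \<Longrightarrow> y i m = 0) \<Longrightarrow> qp y i = 0"
  unfolding queue_prob_def by (intro sum.neutral) auto

lemma admissibleD:
  assumes "admissible y"
  shows "m \<in> {1..M} \<Longrightarrow> 0 \<le> y i m" "m \<in> {1..M} \<Longrightarrow> y i m \<le> ub y i"
    "qp y sums 1" "Q \<le> enat i \<Longrightarrow> m \<in> {1..M} \<Longrightarrow> y i m = 0"
    "0 \<le> qp y i" "Q \<le> enat i \<Longrightarrow> qp y i = 0"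
proof -
  show "0 \<le> qp y i" using assms by (intro qp_nonneg) (auto simp: admissible_def)
  show "Q \<le> enat i \<Longrightarrow> qp y i = 0" using assms by (intro qp_eq_0) (auto simp: admissible_def)
qed (use assms in \<open>auto simp: admissible_def\<close>)

text \<open>The queue distribution is summable, so this domination gives absolute convergence of the
  energy for powers of either sign. It also makes the energy vanish at every empty level.\<close>

lemma energy_bound:
  assumes "admissible y"
  shows "\<bar>energy y i\<bar> \<le> (\<Sum>m = 1..M. \<bar>P m\<bar>) * qp y i"
proof -
  have "\<bar>energy y i\<bar> \<le> (\<Sum>m = 1..M. \<bar>\<eta> m * P m * y i m\<bar>)"
    unfolding energy_def by (rule sum_abs)
  also have "\<dots> \<le> (\<Sum>m = 1..M. (\<Sum>m = 1..M. \<bar>P m\<bar>) * (\<eta> m * y i m))"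
  proof (rule sum_mono)
    fix m assume m: "m \<in> {1..M}"
    have "\<bar>P m\<bar> \<le> (\<Sum>m = 1..M. \<bar>P m\<bar>)" using m by (intro member_le_sum) auto
    moreover have "0 \<le> \<eta> m * y i m" using m assms admissibleD(1) eta_nonneg by simp
    ultimately have "\<bar>P m\<bar> * (\<eta> m * y i m) \<le> (\<Sum>m = 1..M. \<bar>P m\<bar>) * (\<eta> m * y i m)"
      by (rule mult_right_mono)
    moreover have "\<bar>\<eta> m * P m * y i m\<bar> = \<bar>P m\<bar> * (\<eta> m * y i m)"
      using m assms admissibleD(1) eta_nonneg by (simp add: abs_mult)
    ultimately show "\<bar>\<eta> m * P m * y i m\<bar> \<le> (\<Sum>m = 1..M. \<bar>P m\<bar>) * (\<eta> m * y i m)" by simp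
  qed
  also have "\<dots> = (\<Sum>m = 1..M. \<bar>P m\<bar>) * qp y i"
    by (simp add: queue_prob_def sum_distrib_left)
  finally show ?thesis .
qed

lemma energy_abs_summable:
  assumes "admissible y"
  shows "summable (\<lambda>i. norm (energy y i))"
proof (rule summable_comparison_test')
  show "summable (\<lambda>i. (\<Sum>m = 1..M. \<bar>P m\<bar>) * qp y i)"
    using admissibleD(3)[OF assms] by (intro summable_mult) (simp add: sums_iff)
  show "norm (norm (energy y i)) \<le> (\<Sum>m = 1..M. \<bar>P m\<bar>) * qp y i" if "i \<ge> 0" for i
    using energy_bound[OF assms, of i] by simp
qed

lemma energy_sums:
  assumes "admissible y" shows "energy y sums total_energy y"
  unfolding total_energy_def using energy_abs_summable[OF assms] summable_norm_cancel summable_sums by blast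

lemma energy_eq_0: "(\<And>m. m \<in> {1..M} \<Longrightarrow> y i m = 0) \<Longrightarrow> energy y i = 0"
  unfolding energy_def by (intro sum.neutral) auto

lemma avg_power_eq:
  assumes "admissible y" shows "avg_power M \<alpha> \<eta> P Q y = \<alpha> * total_energy y"
proof -
  have "(\<Sum>\<^sub>\<infinity>i\<in>queue_lengths Q. energy y i) = (\<Sum>\<^sub>\<infinity>i. energy y i)"
    using assms by (intro infsum_cong_neutral)
      (auto simp: queue_lengths_def intro!: energy_eq_0 admissibleD(4)[OF assms])
  also have "\<dots> = total_energy y"
    using norm_summable_imp_has_sum[OF energy_abs_summable[OF assms] energy_sums[OF assms]]
    by (rule infsumI)
  finally show ?thesis by (simp add: avg_power_def energy_def)
qed

text \<open>Replaces sums over the set of queue lengths by series over all naturals, on which finite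
  and infinite buffers look alike. Both differ only by zero terms.\<close>

lemma lp_feasible_iff:
  "lp_feasible M \<alpha> \<eta> P Q pmax y \<longleftrightarrow> admissible y \<and> \<alpha> * total_energy y \<le> pmax"
proof
  assume f: "lp_feasible M \<alpha> \<eta> P Q pmax y"
  have qz: "qp y i = 0" if "Q \<le> enat i" for i
  proof (cases "Q = enat i")
    case True then show ?thesis using f by (simp add: lp_feasible_def)
  next
    case False
    then have "i \<notin> queue_lengths Q" using that by (auto simp: queue_lengths_def)
    then show ?thesis using f by (intro qp_eq_0) (simp add: lp_feasible_def)
  qed
  have in_Q: "0 \<le> y i m \<and> y i m \<le> ub y i" if "i \<in> queue_lengths Q" "m \<in> {1..M}" for i m
    using f that by (simp add: lp_feasible_def)
  have yz: "y i m = 0" if Qi: "Q \<le> enat i" and m: "m \<in> {1..M}" for i m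
  proof (cases "i \<in> queue_lengths Q")
    case True
    \<comment> \<open>\<open>qp y i = 0\<close> says nothing about channels with
      \<open>\<eta> m = 0\<close>; they are killed by the upper bound, which needs level
      \<open>i + 1\<close> to be empty too.\<close>
    have "Q \<le> enat (i + 1)" using Qi by (metis enat_ord_simps(1) le_add1 order_trans)
    then have "ub y i = 0" using qz[of i] qz[of "i + 1"] Qi by (simp add: upper_bound_def)
    then show ?thesis using in_Q[OF True m] by simp
  next
    case False then show ?thesis using f m by (simp add: lp_feasible_def)
  qed
  have nn: "0 \<le> y i m" if "m \<in> {1..M}" for i m
    using in_Q[of i m] yz[of i m] that by (cases "i \<in> queue_lengths Q") (auto simp: queue_lengths_def)
  have le: "y i m \<le> ub y i" if m: "m \<in> {1..M}" for i m
  proof (cases "i \<in> queue_lengths Q")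
    case True then show ?thesis using in_Q m by blast
  next
    case False
    then have "y i m = 0" using yz m by (auto simp: queue_lengths_def)
    moreover have "0 \<le> ub y i" unfolding upper_bound_def
      using xi_pos nn by (intro add_nonneg_nonneg mult_nonneg_nonneg qp_nonneg) auto
    ultimately show ?thesis by simp
  qed
  have "(qp y has_sum 1) (queue_lengths Q)"
    using f by (simp add: lp_feasible_def queue_prob_def[abs_def])
  then have "(qp y has_sum 1) UNIV"
    by (rule has_sum_cong_neutral[THEN iffD1, rotated -1])
      (auto simp: queue_lengths_def intro!: qz)
  then have "qp y sums 1" by (rule has_sum_imp_sums)
  then have adm: "admissible y" using nn le yz by (simp add: admissible_def)
  then show "admissible y \<and> \<alpha> * total_energy y \<le> pmax"
    using f avg_power_eq[OF adm] by (simp add: lp_feasible_def)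
next
  assume a: "admissible y \<and> \<alpha> * total_energy y \<le> pmax"
  then have adm: "admissible y" by simp
  have "(qp y has_sum 1) UNIV"
    using admissibleD(3)[OF adm] admissibleD(5)[OF adm] by (simp add: sums_nonneg_imp_has_sum)
  then have "(qp y has_sum 1) (queue_lengths Q)"
    by (rule has_sum_cong_neutral[THEN iffD1, rotated -1])
      (auto simp: queue_lengths_def intro!: admissibleD(6)[OF adm])
  then show "lp_feasible M \<alpha> \<eta> P Q pmax y"
    using a avg_power_eq[OF adm] admissibleD[OF adm]
    by (auto simp: lp_feasible_def queue_prob_def[abs_def] queue_lengths_def)
qed

lemma avg_delay_eq_suminf:
  assumes "admissible y"
  shows "avg_delay M \<alpha> \<eta> Q y = ennreal (1 / \<alpha>) * (\<Sum>i. ennreal (real i * qp y i))"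
proof -
  have "(\<Sum>m = 1..M. real i * \<eta> m * y i m) = real i * qp y i" for i
    by (simp add: queue_prob_def sum_distrib_left mult.assoc)
  moreover have "(\<Sum>\<^sub>\<infinity>i\<in>queue_lengths Q. ennreal (real i * qp y i)) = (\<Sum>\<^sub>\<infinity>i. ennreal (real i * qp y i))"
    using assms by (intro infsum_cong_neutral)
      (auto simp: queue_lengths_def admissibleD(6)[OF assms])
  moreover have "(\<Sum>\<^sub>\<infinity>i. ennreal (real i * qp y i)) = (\<Sum>i. ennreal (real i * qp y i))"
    by (metis has_sum_imp_sums has_sum_infsum nonneg_summable_on_complete sums_unique zero_le)
  ultimately show ?thesis by (simp add: avg_delay_def)
qed

lemma avg_delay_finite:
  assumes "admissible y" "finite_mean y"
  shows "avg_delay M \<alpha> \<eta> Q y = ennreal (mean_queue y / \<alpha>)"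
proof -
  have "(\<Sum>i. ennreal (real i * qp y i)) = ennreal (mean_queue y)"
    unfolding mean_queue_def using assms admissibleD(5)
    by (intro suminf_ennreal2) (auto simp: finite_mean_def)
  moreover have "mean_queue y \<ge> 0" unfolding mean_queue_def
    using assms admissibleD(5) by (intro suminf_nonneg) (auto simp: finite_mean_def)
  ultimately show ?thesis using alpha by (simp add: avg_delay_eq_suminf[OF assms(1)] flip: ennreal_mult)
qed

lemma avg_delay_infinite:
  assumes "admissible y" "\<not> finite_mean y"
  shows "avg_delay M \<alpha> \<eta> Q y = \<infinity>"
proof -
  have "(\<Sum>i. ennreal (real i * qp y i)) = \<infinity>"
  proof (rule ccontr)
    assume "(\<Sum>i. ennreal (real i * qp y i)) \<noteq> \<infinity>"
    then have "summable (\<lambda>i. real i * qp y i)"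
      using admissibleD(5)[OF assms(1)] by (intro summable_suminf_not_top) auto
    then show False using assms by (simp add: finite_mean_def)
  qed
  then show ?thesis using alpha by (simp add: avg_delay_eq_suminf[OF assms(1)] ennreal_mult_top)
qed

end

subsection \<open>Threshold policies and likelihood ratios\<close>

text \<open>The ratio of \<open>a\<close> to \<open>b\<close> is nonincreasing. With
  \<open>n\<close> the last level where \<open>b n \<le> a n\<close>, the difference
  \<open>a - b\<close> is nonnegative up to \<open>n\<close> and nonpositive beyond it, so
  \<open>(i - n) * (a i - b i) \<le> 0\<close> throughout. Summing gives the claim, since equal
  masses cancel the part with \<open>n\<close>.\<close>

lemma likelihood_ratio_mean_le:
  fixes a b :: "nat \<Rightarrow> real"
  assumes "\<And>i. i \<le> K \<Longrightarrow> 0 < b i"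
    and ratio: "\<And>i. i < K \<Longrightarrow> a (Suc i) * b i \<le> b (Suc i) * a i"
    and "(\<Sum>i\<le>K. a i) = 1" "(\<Sum>i\<le>K. b i) = 1"
  shows "(\<Sum>i\<le>K. real i * a i) \<le> (\<Sum>i\<le>K. real i * b i)"
proof -
  define S where "S = {i. i \<le> K \<and> b i \<le> a i}"
  have dec: "a j * b i \<le> b j * a i" if "i \<le> j" "j \<le> K" for i j
    using that
  proof (induction j rule: dec_induct)
    case base then show ?case by simp
  next
    case (step j)
    then have pos: "0 < b i" "0 < b j" "0 < b (Suc j)" using assms(1) by auto
    have "b j * (a (Suc j) * b i) = (a (Suc j) * b j) * b i" by simp
    also have "\<dots> \<le> (b (Suc j) * a j) * b i"
      using ratio[of j] step pos by (intro mult_right_mono) auto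
    also have "\<dots> = b (Suc j) * (a j * b i)" by simp
    also have "\<dots> \<le> b (Suc j) * (b j * a i)"
      using step pos by (intro mult_left_mono) auto
    also have "\<dots> = b j * (b (Suc j) * a i)" by simp
    finally show ?case using pos by simp
  qed
  have fin: "finite S" by (simp add: S_def)
  have ne: "S \<noteq> {}"
  proof
    assume "S = {}"
    then have "a i < b i" if "i \<le> K" for i using that by (force simp: S_def)
    then have "(\<Sum>i\<le>K. a i) < (\<Sum>i\<le>K. b i)" by (intro sum_strict_mono) auto
    then show False using assms by simp
  qed
  define n where "n = Max S"
  have n: "n \<le> K" "b n \<le> a n" using Max_in[OF fin ne] by (auto simp: n_def S_def)
  have "(real i - real n) * (a i - b i) \<le> 0" if i: "i \<le> K" for i
  proof (cases "i \<le> n")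
    case True
    have "b i * b n \<le> b i * a n" using n assms(1)[OF i] by simp
    also have "\<dots> \<le> b n * a i" using dec[OF True n(1)] by (simp add: mult.commute)
    finally have "b i \<le> a i" using assms(1)[OF n(1)] by (simp add: mult.commute)
    then show ?thesis using True by (simp add: mult_nonpos_nonneg)
  next
    case False
    then have "i \<notin> S" using Max_ge[OF fin, of i] by (auto simp: n_def)
    then have "a i \<le> b i" using i by (auto simp: S_def)
    then show ?thesis using False by (simp add: mult_nonneg_nonpos)
  qed
  then have "(\<Sum>i\<le>K. (real i - real n) * (a i - b i)) \<le> 0" by (intro sum_nonpos) auto
  moreover have "(\<Sum>i\<le>K. (real i - real n) * (a i - b i))
      = ((\<Sum>i\<le>K. real i * a i) - (\<Sum>i\<le>K. real i * b i)) - real n * ((\<Sum>i\<le>K. a i) - (\<Sum>i\<le>K. b i))"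
    by (simp add: algebra_simps sum.distrib sum_subtractf sum_distrib_left)
  ultimately show ?thesis using assms by simp
qed

context queue_model
begin

lemma qp_lincomb: "qp (\<lambda>i m. a * y i m + b * z i m) i = a * qp y i + b * qp z i"
  by (simp add: queue_prob_def sum.distrib sum_distrib_left algebra_simps)

lemma ub_lincomb: "ub (\<lambda>i m. a * y i m + b * z i m) i = a * ub y i + b * ub z i"
  unfolding upper_bound_def qp_lincomb by (simp add: algebra_simps)

lemma energy_lincomb: "energy (\<lambda>i m. a * y i m + b * z i m) i = a * energy y i + b * energy z i"
  by (simp add: energy_def sum.distrib sum_distrib_left algebra_simps)

lemma total_energy_lincomb:
  assumes "admissible y" "admissible z"
  shows "total_energy (\<lambda>i m. a * y i m + b * z i m) = a * total_energy y + b * total_energy z"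
proof -
  have "(\<lambda>i. a * energy y i + b * energy z i) sums (a * total_energy y + b * total_energy z)"
    using assms by (intro sums_add sums_mult energy_sums)
  then show ?thesis by (simp add: total_energy_def energy_lincomb sums_iff)
qed

lemma finite_meanD: "finite_mean y \<Longrightarrow> (\<lambda>i. real i * qp y i) sums mean_queue y"
  by (simp add: finite_mean_def mean_queue_def summable_sums)

lemma mean_lincomb:
  assumes "finite_mean y" "finite_mean z"
  shows "finite_mean (\<lambda>i m. a * y i m + b * z i m)"
    "mean_queue (\<lambda>i m. a * y i m + b * z i m) = a * mean_queue y + b * mean_queue z"
proof -
  have "(\<lambda>i. a * (real i * qp y i) + b * (real i * qp z i)) sums (a * mean_queue y + b * mean_queue z)"
    using assms by (intro sums_add sums_mult finite_meanD)
  then have "(\<lambda>i. real i * qp (\<lambda>i m. a * y i m + b * z i m) i) sums (a * mean_queue y + b * mean_queue z)"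
    by (simp add: qp_lincomb algebra_simps)
  then show "finite_mean (\<lambda>i m. a * y i m + b * z i m)"
    "mean_queue (\<lambda>i m. a * y i m + b * z i m) = a * mean_queue y + b * mean_queue z"
    by (auto simp: finite_mean_def mean_queue_def sums_iff)
qed

lemma admissible_convex:
  assumes "admissible y" "admissible z" "0 \<le> a" "0 \<le> b" "a + b = 1"
  shows "admissible (\<lambda>i m. a * y i m + b * z i m)"
  unfolding admissible_def
proof (intro conjI allI ballI impI)
  fix i m assume m: "m \<in> {1..M}"
  show "0 \<le> a * y i m + b * z i m"
    using assms m by (intro add_nonneg_nonneg mult_nonneg_nonneg) (auto simp: admissibleD(1))
  show "a * y i m + b * z i m \<le> ub (\<lambda>i m. a * y i m + b * z i m) i"
    unfolding ub_lincomb using assms m by (intro add_mono mult_left_mono admissibleD(2)) auto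
  assume "Q \<le> enat i"
  then show "a * y i m + b * z i m = 0" using assms m by (simp add: admissibleD(4))
next
  have "(\<lambda>i. a * qp y i + b * qp z i) sums (a * 1 + b * 1)"
    using assms by (intro sums_add sums_mult admissibleD(3))
  then show "qp (\<lambda>i m. a * y i m + b * z i m) sums 1"
    using assms unfolding qp_lincomb[abs_def] by simp
qed

lemma bounded_support:
  assumes "admissible y" "\<And>i. i > K \<Longrightarrow> qp y i = 0"
  shows "finite_mean y" "mean_queue y = (\<Sum>i\<le>K. real i * qp y i)"
    "total_energy y = (\<Sum>i\<le>K. energy y i)" "(\<Sum>i\<le>K. qp y i) = 1"
proof -
  have *: "f sums (\<Sum>i\<le>K. f i)" if "\<And>i. i > K \<Longrightarrow> f i = 0" for f :: "nat \<Rightarrow> real"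
    using that by (intro sums_finite) auto
  have "(\<lambda>i. real i * qp y i) sums (\<Sum>i\<le>K. real i * qp y i)" using assms by (intro *) simp
  then show "finite_mean y" "mean_queue y = (\<Sum>i\<le>K. real i * qp y i)"
    by (auto simp: finite_mean_def mean_queue_def sums_iff)
  have "energy y sums (\<Sum>i\<le>K. energy y i)"
    using energy_bound[OF assms(1)] assms(2) by (intro *) (metis abs_le_zero_iff mult_zero_right)
  then show "total_energy y = (\<Sum>i\<le>K. energy y i)" by (simp add: total_energy_def sums_iff)
  have "qp y sums (\<Sum>i\<le>K. qp y i)" using assms by (intro *) simp
  then show "(\<Sum>i\<le>K. qp y i) = 1" using admissibleD(3)[OF assms(1)] sums_unique2 by blast
qed

text \<open>The probability that the channel state allows a transmission at queue length
  \<open>i\<close>; for \<open>thr_policy T\<close> it is the factor between \<open>ub\<close> and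
  \<open>qp\<close>.\<close>

definition serve :: "(nat \<Rightarrow> nat) \<Rightarrow> nat \<Rightarrow> real" where
  "serve T i = (\<Sum>m = 1..M. \<eta> m * (if T m \<le> i then 1 else 0))"

text \<open>
  The recursion comes from \<open>\<pi>\<^sub>i = serve T i \<cdot> (\<pi>\<^sub>i + \<xi> \<pi>\<^sub>i\<^sub>+\<^sub>1)\<close>; it is meaningful only if \<open>serve T 0 > 0\<close>.
\<close>

primrec weight :: "(nat \<Rightarrow> nat) \<Rightarrow> nat \<Rightarrow> real" where
  "weight T 0 = 1"
| "weight T (Suc i) = weight T i * (1 - serve T i) / (\<xi> * serve T i)"

definition thr_dist :: "(nat \<Rightarrow> nat) \<Rightarrow> nat \<Rightarrow> real" where
  "thr_dist T i = weight T i / (\<Sum>j. weight T j)"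

text \<open>The value of a transmitting channel is the policy's own upper bound, written out by
  means of \<open>thr_dist\<close> because \<open>ub\<close> would refer to the policy being
  defined.\<close>

definition thr_policy :: "(nat \<Rightarrow> nat) \<Rightarrow> nat \<Rightarrow> nat \<Rightarrow> real" where
  "thr_policy T i m = (if T m \<le> i then thr_dist T i + \<xi> * thr_dist T (Suc i) else 0)"

lemma serve_bounds: "0 \<le> serve T i" "serve T i \<le> 1"
proof -
  show "0 \<le> serve T i" unfolding serve_def using eta_nonneg by (intro sum_nonneg) auto
  have "serve T i \<le> (\<Sum>m = 1..M. \<eta> m)"
    unfolding serve_def using eta_nonneg by (intro sum_mono) auto
  then show "serve T i \<le> 1" using eta_sum by simp
qed

lemma serve_mono: "i \<le> j \<Longrightarrow> serve T i \<le> serve T j"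
  unfolding serve_def using eta_nonneg by (intro sum_mono) auto

lemma serve_eq_1: "(\<And>m. m \<in> {1..M} \<Longrightarrow> T m \<le> i) \<Longrightarrow> serve T i = 1"
  unfolding serve_def using eta_sum by simp

lemma weight_nonneg: "0 \<le> weight T i"
  using xi_pos serve_bounds by (induction i) (auto intro!: divide_nonneg_nonneg mult_nonneg_nonneg)

context
  fixes T K
  assumes T_le: "\<And>m. m \<in> {1..M} \<Longrightarrow> T m \<le> K" and K: "enat K < Q" and serve_0: "0 < serve T 0"
begin

lemma weight_eq_0: "i > K \<Longrightarrow> weight T i = 0"
proof (induction i)
  case (Suc i)
  then have "serve T i = 1" by (intro serve_eq_1) (meson T_le le_trans less_Suc_eq_le)
  then show ?case by simp
qed simp

lemma weight_sums: "weight T sums (\<Sum>i. weight T i)"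
  using weight_eq_0 by (intro summable_sums summable_finite[of "{..K}"]) auto

lemma weight_sum_pos: "0 < (\<Sum>i. weight T i)"
  using weight_sums weight_nonneg by (intro suminf_pos2[of _ 0]) (auto simp: sums_iff)

lemma thr_dist_props:
  "thr_dist T sums 1" "0 \<le> thr_dist T i" "K < i \<Longrightarrow> thr_dist T i = 0"
  "serve T i * (thr_dist T i + \<xi> * thr_dist T (Suc i)) = thr_dist T i"
proof -
  show "thr_dist T sums 1"
    using sums_divide[OF weight_sums, of "\<Sum>i. weight T i"] weight_sum_pos
    by (simp add: thr_dist_def[abs_def])
  show "0 \<le> thr_dist T i" using weight_nonneg weight_sum_pos by (simp add: thr_dist_def)
  show "K < i \<Longrightarrow> thr_dist T i = 0" by (simp add: thr_dist_def weight_eq_0)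
  have "0 < serve T i" using serve_0 serve_mono[of 0 i T] by simp
  then have "serve T i * (weight T i + \<xi> * weight T (Suc i)) = weight T i"
    using xi_pos by (simp add: field_simps)
  then show "serve T i * (thr_dist T i + \<xi> * thr_dist T (Suc i)) = thr_dist T i"
    unfolding thr_dist_def by (metis add_divide_distrib times_divide_eq_right)
qed

lemma qp_thr_policy: "qp (thr_policy T) i = thr_dist T i"
proof -
  have "qp (thr_policy T) i = serve T i * (thr_dist T i + \<xi> * thr_dist T (Suc i))"
    unfolding queue_prob_def serve_def thr_policy_def sum_distrib_right
    by (intro sum.cong) auto
  then show ?thesis using thr_dist_props(4) by simp
qed

lemma ub_thr_policy: "ub (thr_policy T) i = thr_dist T i + \<xi> * thr_dist T (Suc i)"
  by (simp add: upper_bound_def qp_thr_policy)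

lemma thr_policy_eq: "thr_policy T i m = (if T m \<le> i then ub (thr_policy T) i else 0)"
  by (simp add: ub_thr_policy thr_policy_def)

lemma thr_policy_admissible: "admissible (thr_policy T)"
  unfolding admissible_def
proof (intro conjI allI ballI impI)
  fix i m
  show "0 \<le> thr_policy T i m" "thr_policy T i m \<le> ub (thr_policy T) i"
    using xi_pos thr_dist_props(2) by (auto simp: thr_policy_eq ub_thr_policy)
  assume "Q \<le> enat i"
  then have "K < i" using K by (metis enat_ord_simps(2) order_less_le_trans)
  then show "thr_policy T i m = 0" by (simp add: thr_policy_def thr_dist_props(3))
next
  show "qp (thr_policy T) sums 1" using thr_dist_props(1) by (simp add: qp_thr_policy[abs_def])
qed

lemma thr_policy_support: "i > K \<Longrightarrow> qp (thr_policy T) i = 0"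
  by (simp add: qp_thr_policy thr_dist_props(3))

lemma thr_dist_pos:
  assumes "i \<le> K" "\<And>j. j < K \<Longrightarrow> serve T j < 1"
  shows "0 < thr_dist T i"
proof -
  have "0 < weight T i" using assms(1)
  proof (induction i)
    case (Suc i)
    have "0 < serve T i" using serve_0 serve_mono[of 0 i T] by simp
    then show ?case using Suc assms(2)[of i] xi_pos by simp
  qed simp
  then show ?thesis using weight_sum_pos by (simp add: thr_dist_def)
qed

end

subsection \<open>The dual recursion\<close>

text \<open>Channels of probability 0 contribute to no sum, so extreme powers and strict
  inequalities have to be taken over the remaining channels.\<close>

definition used :: "nat set" where "used = {m \<in> {1..M}. 0 < \<eta> m}"
definition P_min :: real where "P_min = Min (P ` used)"
definition P_max :: real where "P_max = Max (P ` used)"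

text \<open>The function F of the recursion: the expected gain if a transmission earns
  \<open>c\<close> and takes place exactly in the channels cheaper than \<open>c\<close>.\<close>

definition surplus :: "real \<Rightarrow> real" where
  "surplus c = (\<Sum>m = 1..M. \<eta> m * max 0 (c - P m))"

lemma used_finite: "finite used" by (simp add: used_def)

lemma used_nonempty: "used \<noteq> {}"
proof
  assume "used = {}"
  then have "(\<Sum>m = 1..M. \<eta> m) \<le> 0" by (intro sum_nonpos) (auto simp: used_def not_less)
  then show False using eta_sum by simp
qed

lemma P_bounds: "m \<in> used \<Longrightarrow> P_min \<le> P m" "m \<in> used \<Longrightarrow> P m \<le> P_max"
  using used_finite by (auto simp: P_min_def P_max_def)

lemma P_min_attained: "\<exists>m\<in>used. P m = P_min"
proof -
  have "P_min \<in> P ` used" unfolding P_min_def using used_finite used_nonempty by (intro Min_in) auto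
  then show ?thesis by auto
qed

lemma P_max_attained: "\<exists>m\<in>used. P m = P_max"
proof -
  have "P_max \<in> P ` used" unfolding P_max_def using used_finite used_nonempty by (intro Max_in) auto
  then show ?thesis by auto
qed

lemma P_1_le: "P 1 \<le> P_min"
proof -
  obtain m where "m \<in> used" "P m = P_min" using P_min_attained by blast
  then show ?thesis using mono_onD[OF P_mono, of 1 m] by (auto simp: used_def)
qed

lemma eta_0: "m \<in> {1..M} \<Longrightarrow> m \<notin> used \<Longrightarrow> \<eta> m = 0"
  using eta_nonneg[of m] by (auto simp: used_def)

lemma sum_used_cong:
  assumes "\<And>m. m \<in> used \<Longrightarrow> f m = g m"
  shows "(\<Sum>m = 1..M. \<eta> m * f m) = (\<Sum>m = 1..M. \<eta> m * g m)"
  using assms eta_0 by (intro sum.cong) auto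

lemma sum_used_mono:
  assumes "\<And>m. m \<in> used \<Longrightarrow> f m \<le> g m"
  shows "(\<Sum>m = 1..M. \<eta> m * f m) \<le> (\<Sum>m = 1..M. \<eta> m * g m)"
proof (rule sum_mono)
  fix m assume m: "m \<in> {1..M}"
  show "\<eta> m * f m \<le> \<eta> m * g m"
    using assms[of m] eta_0[OF m] eta_nonneg[OF m] by (cases "m \<in> used") (auto intro: mult_left_mono)
qed

lemma sum_used_strict_mono:
  assumes "\<And>m. m \<in> used \<Longrightarrow> f m \<le> g m" "m \<in> used" "f m < g m"
  shows "(\<Sum>m = 1..M. \<eta> m * f m) < (\<Sum>m = 1..M. \<eta> m * g m)"
proof (rule sum_strict_mono_ex1)
  show "\<forall>m\<in>{1..M}. \<eta> m * f m \<le> \<eta> m * g m"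
    using assms(1) eta_0 eta_nonneg
    by (metis mult_left_mono mult_zero_left order_refl)
  show "\<exists>m\<in>{1..M}. \<eta> m * f m < \<eta> m * g m"
    using assms by (intro bexI[of _ m]) (auto simp: used_def)
qed simp

lemma sum_used_eq_0:
  assumes "\<And>m. m \<in> used \<Longrightarrow> 0 \<le> f m" "(\<Sum>m = 1..M. \<eta> m * f m) = 0" "m \<in> used"
  shows "f m = 0"
  using sum_used_strict_mono[of "\<lambda>_. 0" f m] assms by (force simp: less_le)

lemma surplus_mono: "a \<le> b \<Longrightarrow> surplus a \<le> surplus b"
  unfolding surplus_def by (rule sum_used_mono) auto

lemma surplus_strict_mono:
  assumes "a < b" "P_min < b" shows "surplus a < surplus b"
proof -
  obtain m where "m \<in> used" "P m = P_min" using P_min_attained by blast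
  then show ?thesis unfolding surplus_def using assms
    by (intro sum_used_strict_mono[of _ _ m]) auto
qed

lemma surplus_eq_0: "c \<le> P_min \<Longrightarrow> surplus c = 0"
  unfolding surplus_def using P_bounds(1)
  by (subst sum_used_cong[of _ "\<lambda>_. 0"]) force+

text \<open>Since \<open>c - max 0 (c - P m) = min c (P m)\<close>, the difference is an expected
  minimum. This shows at once that it increases strictly below \<open>P_max\<close> and is constant
  above.\<close>

lemma diff_surplus: "c - surplus c = (\<Sum>m = 1..M. \<eta> m * min c (P m))"
proof -
  have "c - surplus c = (\<Sum>m = 1..M. \<eta> m * c) - surplus c"
    using eta_sum by (simp flip: sum_distrib_right)
  also have "\<dots> = (\<Sum>m = 1..M. \<eta> m * min c (P m))"
    unfolding surplus_def sum_subtractf[symmetric]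
    by (intro sum.cong) (auto simp: min_def max_def algebra_simps)
  finally show ?thesis .
qed

lemma diff_surplus_strict_mono:
  assumes "a < b" "a < P_max" shows "a - surplus a < b - surplus b"
proof -
  obtain m where "m \<in> used" "P m = P_max" using P_max_attained by blast
  then show ?thesis unfolding diff_surplus using assms
    by (intro sum_used_strict_mono[of _ _ m]) auto
qed

lemma diff_surplus_P_max: "c \<ge> P_max \<Longrightarrow> c - surplus c = mean_P"
  unfolding diff_surplus mean_P_def using P_bounds(2) by (intro sum_used_cong) force

text \<open>
  Beyond \<open>P_max\<close> the function \<open>c - surplus c\<close> is constant, so the bound \<open>P_max\<close> selects the least solution.
  For \<open>r > mean_P\<close> there is none and the value is junk.
\<close>

definition critical :: "real \<Rightarrow> real" where
  "critical r = (SOME c. c \<le> P_max \<and> c - surplus c = r)"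

lemma critical:
  assumes "r \<le> mean_P"
  shows "critical r \<le> P_max" "critical r - surplus (critical r) = r"
proof -
  have le: "P_min \<le> P_max" using P_bounds used_nonempty by force
  \<comment> \<open>At or below \<open>P_min\<close> the surplus vanishes, so the left end of the
    interval has a value of at most \<open>r\<close>.\<close>
  define a where "a = min r P_min"
  have "\<exists>c. a \<le> c \<and> c \<le> P_max \<and> c - surplus c = r"
  proof (rule IVT')
    show "a - surplus a \<le> r" using surplus_eq_0[of a] by (simp add: a_def)
    show "r \<le> P_max - surplus P_max" using diff_surplus_P_max[of P_max] assms by simp
    show "a \<le> P_max" using le by (simp add: a_def)
    show "continuous_on {a..P_max} (\<lambda>c. c - surplus c)"
      unfolding surplus_def by (intro continuous_intros)
  qed
  then have "\<exists>c. c \<le> P_max \<and> c - surplus c = r" by blast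
  from someI_ex[OF this] show "critical r \<le> P_max" "critical r - surplus (critical r) = r"
    by (auto simp: critical_def)
qed

lemma critical_less_iff:
  assumes "r \<le> mean_P" "s \<le> mean_P"
  shows "critical r < critical s \<longleftrightarrow> r < s"
proof
  assume "critical r < critical s"
  then show "r < s" using diff_surplus_strict_mono[of "critical r" "critical s"]
      critical[OF assms(1)] critical[OF assms(2)] by simp
next
  assume "r < s"
  show "critical r < critical s"
  proof (rule ccontr)
    assume "\<not> critical r < critical s"
    then consider "critical s = critical r" | "critical s < critical r" by force
    then show False
    proof cases
      case 2
      then show ?thesis using diff_surplus_strict_mono[of "critical s" "critical r"] \<open>r < s\<close>
        critical[OF assms(1)] critical[OF assms(2)] by simp
    qed (use \<open>r < s\<close> critical[OF assms(1)] critical[OF assms(2)] in simp)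
  qed
qed

text \<open>The prescribed values of \<open>c - surplus c\<close> at the successive levels; the dual
  variables \<open>c\<close> themselves are \<open>crit\<close>. Here \<open>\<kappa>\<close> is the
  price of queue length and \<open>v\<close> the price of the normalisation.\<close>

primrec net :: "real \<Rightarrow> real \<Rightarrow> nat \<Rightarrow> real" where
  "net \<kappa> v 0 = v"
| "net \<kappa> v (Suc i) = v - \<kappa> * real (Suc i) + \<xi> * surplus (critical (net \<kappa> v i))"

definition crit :: "real \<Rightarrow> real \<Rightarrow> nat \<Rightarrow> real" where
  "crit \<kappa> v i = critical (net \<kappa> v i)"

text \<open>The loss at level \<open>i\<close> against the best choice of each \<open>y i m\<close>
  between 0 and \<open>ub y i\<close>, if a transmission in channel \<open>m\<close> earns
  \<open>c - P m\<close>.\<close>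

definition slack :: "real \<Rightarrow> (nat \<Rightarrow> nat \<Rightarrow> real) \<Rightarrow> nat \<Rightarrow> real" where
  "slack c y i = (\<Sum>m = 1..M. \<eta> m * (max 0 (c - P m) * ub y i - (c - P m) * y i m))"

lemma slack_eq: "slack c y i = surplus c * ub y i - c * qp y i + energy y i"
  by (simp add: slack_def surplus_def queue_prob_def energy_def sum_distrib_left sum_distrib_right
      sum_subtractf[symmetric] sum.distrib[symmetric] algebra_simps)

text \<open>The recursion for \<open>net\<close> is made for this telescoping: the part of the slack
  at level \<open>N\<close> that involves \<open>qp y (Suc N)\<close> is exactly the change of the
  boundary term.\<close>

lemma partial_lagrangian:
  assumes "\<And>i. i < N \<Longrightarrow> net \<kappa> v i \<le> mean_P"
  shows "(\<Sum>i<N. (\<kappa> * real i - v) * qp y i + energy y i)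
    = (\<Sum>i<N. slack (crit \<kappa> v i) y i) - qp y N * (net \<kappa> v N - v + \<kappa> * real N)"
  using assms
proof (induction N)
  case (Suc N)
  let ?c = "crit \<kappa> v N"
  have c: "?c - surplus ?c = net \<kappa> v N" using critical Suc.prems by (simp add: crit_def)
  have n: "net \<kappa> v (Suc N) - v + \<kappa> * real (Suc N) = \<xi> * surplus ?c" by (simp add: crit_def)
  have "slack ?c y N = energy y N - qp y N * (?c - surplus ?c) + qp y (Suc N) * (\<xi> * surplus ?c)"
    by (simp add: slack_eq upper_bound_def algebra_simps)
  then have "slack ?c y N = energy y N - qp y N * net \<kappa> v N
      + qp y (Suc N) * (net \<kappa> v (Suc N) - v + \<kappa> * real (Suc N))" unfolding c n .
  moreover have "(\<Sum>i<N. (\<kappa> * real i - v) * qp y i + energy y i)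
    = (\<Sum>i<N. slack (crit \<kappa> v i) y i) - qp y N * (net \<kappa> v N - v + \<kappa> * real N)"
    using Suc by simp
  ultimately show ?case by (simp add: algebra_simps)
qed simp

text \<open>
  Once \<open>crit\<close> fails to increase, \<open>net\<close> drops by at least \<open>\<kappa>\<close> in each step.  For \<open>\<kappa> > 0\<close> it cannot come back to
  \<open>mean_P\<close>.  For \<open>\<kappa> = 0\<close> the first failure would have \<open>net = mean_P\<close> at it and
  just before it, contradicting the strict increase of \<open>crit\<close> before it.
\<close>

lemma crit_increasing:
  assumes "0 \<le> \<kappa>" "P_min < P_max"
    and le: "\<And>i. i < k \<Longrightarrow> net \<kappa> v i \<le> mean_P" and top: "mean_P \<le> net \<kappa> v k"
  shows "0 < k \<Longrightarrow> P_min < crit \<kappa> v 0" "Suc i < k \<Longrightarrow> crit \<kappa> v i < crit \<kappa> v (Suc i)"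
proof -
  \<comment> \<open>A dual variable \<open>P_min\<close> is placed before level 0. Its surplus is 0,
    so that one formula for \<open>net\<close> covers all levels.\<close>
  define prev where "prev i = (case i of 0 \<Rightarrow> P_min | Suc j \<Rightarrow> crit \<kappa> v j)" for i
  have net: "net \<kappa> v i = v - \<kappa> * real i + \<xi> * surplus (prev i)" for i
    using surplus_eq_0[of P_min] by (cases i) (auto simp: prev_def crit_def)
  have cr: "crit \<kappa> v i \<le> P_max" "crit \<kappa> v i - surplus (crit \<kappa> v i) = net \<kappa> v i" if "i < k" for i
    using critical le that by (auto simp: crit_def)
  have main: "prev i < crit \<kappa> v i" if "i < k" for i
    using that
  proof (induction i rule: less_induct)
    case (less i)
    show ?case
    proof (rule ccontr)
      assume "\<not> prev i < crit \<kappa> v i"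
      then have i: "crit \<kappa> v i \<le> prev i" by simp
      have one_step: "net \<kappa> v (Suc j) \<le> net \<kappa> v j - \<kappa>" if "crit \<kappa> v j \<le> prev j" for j
        using surplus_mono[OF that] xi_pos unfolding net[of j]
        by (simp add: crit_def algebra_simps)
      have dec: "crit \<kappa> v j \<le> prev j" if "i \<le> j" "j < k" for j
        using that
      proof (induction j rule: dec_induct)
        case (step j)
        then have "net \<kappa> v (Suc j) \<le> net \<kappa> v j" using one_step[of j] assms(1) by simp
        then show ?case using critical_less_iff[of "net \<kappa> v j" "net \<kappa> v (Suc j)"] le[of j] le[of "Suc j"] step.prems
          by (simp add: prev_def crit_def flip: not_less)
      qed (use i in simp)
      have desc: "net \<kappa> v j \<le> net \<kappa> v i - \<kappa>" if "Suc i \<le> j" "j \<le> k" for j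
        using that
      proof (induction j rule: dec_induct)
        case base then show ?case using one_step i by simp
      next
        case (step j)
        then have "net \<kappa> v (Suc j) \<le> net \<kappa> v j - \<kappa>"
          using one_step[of j] dec[of j] by simp
        then show ?case using step assms(1) by simp
      qed
      have "mean_P \<le> net \<kappa> v i - \<kappa>" by (rule order_trans[OF top desc[OF Suc_leI[OF less.prems] order_refl]])
      then have k0: "\<kappa> = 0" and r: "net \<kappa> v i = mean_P" using assms(1) le[OF less.prems] by auto
      have cX: "crit \<kappa> v i = P_max"
      proof (rule ccontr)
        assume "crit \<kappa> v i \<noteq> P_max"
        then have "crit \<kappa> v i - surplus (crit \<kappa> v i) < P_max - surplus P_max"
          using cr(1)[OF less.prems] by (intro diff_surplus_strict_mono) auto
        then show False using cr(2)[OF less.prems] r diff_surplus_P_max[of P_max] by simp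
      qed
      show False
      proof (cases i)
        case 0 then show False using i cX assms(2) by (simp add: prev_def)
      next
        case (Suc h)
        then have h: "h < k" "h < i" using less.prems by auto
        have "crit \<kappa> v h = P_max" using i cX cr(1)[OF h(1)] Suc by (simp add: prev_def)
        then have "net \<kappa> v h = mean_P" using cr(2)[OF h(1)] diff_surplus_P_max[of P_max] by simp
        moreover have "prev h < crit \<kappa> v h" using less.IH h by blast
        then have "surplus (prev h) < surplus (crit \<kappa> v h)"
          using \<open>crit \<kappa> v h = P_max\<close> assms(2) by (intro surplus_strict_mono) auto
        then have "net \<kappa> v h < net \<kappa> v i"
          using xi_pos Suc k0 unfolding net by (simp add: prev_def)
        ultimately show False using r by simp
      qed
    qed
  qed
  show "0 < k \<Longrightarrow> P_min < crit \<kappa> v 0" using main[of 0] by (simp add: prev_def)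
  show "Suc i < k \<Longrightarrow> crit \<kappa> v i < crit \<kappa> v (Suc i)" using main[of "Suc i"] by (simp add: prev_def)
qed

end

text \<open>Thresholds will be first levels at which a price condition holds. The cap
  \<open>K\<close> makes them exist in any case, and persistence of the condition is required only
  below \<open>K\<close>.\<close>

lemma Least_capped_le_iff:
  fixes i K :: nat
  assumes "\<And>j. Suc j < K \<Longrightarrow> p j \<Longrightarrow> p (Suc j)" "i < K"
  shows "(LEAST j. j = K \<or> p j) \<le> i \<longleftrightarrow> p i"
proof
  assume le: "(LEAST j. j = K \<or> p j) \<le> i"
  have "(LEAST j. j = K \<or> p j) = K \<or> p (LEAST j. j = K \<or> p j)" by (rule LeastI[of _ K]) simp
  then have "p (LEAST j. j = K \<or> p j)" using le assms(2) by simp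
  with le show "p i" using assms(2)
  proof (induction i rule: dec_induct)
    case (step n) then show ?case using assms(1)[of n] by simp
  qed
qed (simp add: Least_le)

lemma Least_capped_le: "(LEAST j. j = (K::nat) \<or> p j) \<le> K"
  by (rule Least_le) simp

section \<open>Complementary slackness and policies defined by dual prices\<close>

context queue_model
begin

lemma slack_term_nonneg:
  assumes "admissible y" "m \<in> {1..M}"
  shows "0 \<le> max 0 (c - P m) * ub y i - (c - P m) * y i m"
proof (cases "P m \<le> c")
  case True
  then have "(c - P m) * y i m \<le> (c - P m) * ub y i"
    using assms by (intro mult_left_mono admissibleD(2)) auto
  then show ?thesis using True by simp
next
  case False
  then have "(c - P m) * y i m \<le> 0"
    using assms by (intro mult_nonpos_nonneg admissibleD(1)) auto
  then show ?thesis using False by simp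
qed

lemma used_le_M: "m \<in> used \<Longrightarrow> m \<in> {1..M}" by (simp add: used_def)

lemma slack_nonneg: "admissible y \<Longrightarrow> 0 \<le> slack c y i"
  unfolding slack_def using eta_nonneg slack_term_nonneg by (intro sum_nonneg mult_nonneg_nonneg) auto

text \<open>Complementary slackness: all weighted terms of the slack are nonnegative, so a zero sum
  makes each term of a channel of positive probability vanish.\<close>

lemma slack_eq_0D:
  assumes "admissible y" "slack c y i = 0" "m \<in> used"
  shows "c < P m \<Longrightarrow> y i m = 0" "P m < c \<Longrightarrow> y i m = ub y i"
proof -
  have "max 0 (c - P m) * ub y i - (c - P m) * y i m = 0"
    using assms slack_term_nonneg[OF assms(1) used_le_M] unfolding slack_def
    by (intro sum_used_eq_0[where f = "\<lambda>m. max 0 (c - P m) * ub y i - (c - P m) * y i m"]) auto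
  then show "c < P m \<Longrightarrow> y i m = 0" "P m < c \<Longrightarrow> y i m = ub y i" by (auto simp: max_def)
qed

lemma lagrangian_sums:
  assumes "admissible y" "finite_mean y"
  shows "(\<lambda>i. (\<kappa> * real i - v) * qp y i + energy y i) sums (total_energy y + \<kappa> * mean_queue y - v)"
proof -
  have "(\<lambda>i. energy y i + \<kappa> * (real i * qp y i) - v * qp y i) sums (total_energy y + \<kappa> * mean_queue y - v * 1)"
    using assms by (intro sums_add sums_diff sums_mult energy_sums finite_meanD admissibleD(3))
  then show ?thesis by (simp add: algebra_simps)
qed

text \<open>A policy that obeys the prices has no slack below \<open>K\<close>. At \<open>K\<close>
  every channel transmits and the levels above are empty, so the energy there is
  \<open>mean_P * qp (thr_policy T) K\<close>. Only the boundary at \<open>K\<close> is left, and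
  \<open>net \<kappa> v K\<close> against \<open>mean_P\<close> decides its sign.\<close>

lemma thr_policy_lagrangian:
  assumes T: "\<And>m. m \<in> {1..M} \<Longrightarrow> T m \<le> K" and K: "enat K < Q" and s0: "0 < serve T 0"
    and net: "\<And>i. i < K \<Longrightarrow> net \<kappa> v i \<le> mean_P"
    and on: "\<And>i m. i < K \<Longrightarrow> m \<in> used \<Longrightarrow> T m \<le> i \<Longrightarrow> P m \<le> crit \<kappa> v i"
    and off: "\<And>i m. i < K \<Longrightarrow> m \<in> used \<Longrightarrow> i < T m \<Longrightarrow> crit \<kappa> v i \<le> P m"
  shows "total_energy (thr_policy T) + \<kappa> * mean_queue (thr_policy T) - v
    = qp (thr_policy T) K * (mean_P - net \<kappa> v K)"
proof -
  let ?y = "thr_policy T"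
  have sup: "qp ?y i = 0" if "K < i" for i using thr_policy_support[OF T K s0] that by simp
  note pol = thr_policy_admissible[OF T K s0] sup
  have eq: "?y i m = (if T m \<le> i then ub ?y i else 0)" for i m using thr_policy_eq[OF T K s0] by simp
  have slack0: "slack (crit \<kappa> v i) ?y i = 0" if i: "i < K" for i
  proof -
    have "max 0 (crit \<kappa> v i - P m) * ub ?y i - (crit \<kappa> v i - P m) * ?y i m = 0" if "m \<in> used" for m
      using on[OF i that] off[OF i that] eq[of i m] by (cases "T m \<le> i") auto
    then have "slack (crit \<kappa> v i) ?y i = (\<Sum>m = 1..M. \<eta> m * 0)"
      unfolding slack_def by (intro sum_used_cong) auto
    then show ?thesis by simp
  qed
  have "energy ?y K = (\<Sum>m = 1..M. \<eta> m * P m * ub ?y K)"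
    unfolding energy_def using T by (intro sum.cong) (auto simp: eq)
  also have "\<dots> = mean_P * qp ?y K"
    using pol(2)[of "Suc K"] by (simp add: mean_P_def upper_bound_def sum_distrib_right)
  finally have eK: "energy ?y K = mean_P * qp ?y K" .
  have "energy ?y i = 0" if "K < i" for i
    using energy_bound[OF pol(1), of i] pol(2)[OF that] by simp
  then have "(\<lambda>i. (\<kappa> * real i - v) * qp ?y i + energy ?y i) sums
      (\<Sum>i\<le>K. (\<kappa> * real i - v) * qp ?y i + energy ?y i)"
    using pol(2) by (intro sums_finite) auto
  moreover have "finite_mean ?y" by (rule bounded_support(1)[OF pol(1,2)])
  ultimately have "total_energy ?y + \<kappa> * mean_queue ?y - v
      = (\<Sum>i\<le>K. (\<kappa> * real i - v) * qp ?y i + energy ?y i)"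
    using lagrangian_sums[OF pol(1)] sums_unique2 by blast
  also have "\<dots> = (\<Sum>i<K. (\<kappa> * real i - v) * qp ?y i + energy ?y i) + ((\<kappa> * real K - v) * qp ?y K + energy ?y K)"
    by (simp flip: lessThan_Suc_atMost)
  also have "\<dots> = qp ?y K * (mean_P - net \<kappa> v K)"
    using partial_lagrangian[of K \<kappa> v ?y] net slack0 eK by (simp add: algebra_simps)
  finally show ?thesis .
qed

text \<open>A channel with \<open>P m = crit \<kappa> v i\<close> is undecided at level
  \<open>i\<close>. \<open>thr_above\<close> and \<open>thr_below\<close> are the two extreme
  decisions: not to transmit at a tie, and to transmit.\<close>

definition thr_above :: "real \<Rightarrow> real \<Rightarrow> nat \<Rightarrow> nat \<Rightarrow> nat" where
  "thr_above \<kappa> v K m = (LEAST i. i = K \<or> P m < crit \<kappa> v i)"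

definition thr_below :: "real \<Rightarrow> real \<Rightarrow> nat \<Rightarrow> nat \<Rightarrow> nat" where
  "thr_below \<kappa> v K m = (LEAST i. i = K \<or> P m \<le> crit \<kappa> v i)"

lemma thr_capped: "thr_above \<kappa> v K m \<le> K" "thr_below \<kappa> v K m \<le> K"
  unfolding thr_above_def thr_below_def by (rule Least_capped_le)+

lemma thr_iff:
  assumes "\<And>i. Suc i < K \<Longrightarrow> crit \<kappa> v i < crit \<kappa> v (Suc i)" "i < K"
  shows "thr_above \<kappa> v K m \<le> i \<longleftrightarrow> P m < crit \<kappa> v i"
    "thr_below \<kappa> v K m \<le> i \<longleftrightarrow> P m \<le> crit \<kappa> v i"
  unfolding thr_above_def thr_below_def using assms by (intro Least_capped_le_iff; force)+

text \<open>A cheapest channel of positive probability has threshold 0: by the price at level 0, or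
  by the cap if \<open>K = 0\<close>.\<close>

lemma serve_0_pos:
  assumes "K > 0 \<Longrightarrow> P_min < crit \<kappa> v 0" "\<And>m. m \<in> {1..M} \<Longrightarrow> T m \<le> thr_above \<kappa> v K m"
  shows "0 < serve T 0"
proof -
  obtain m where m: "m \<in> used" "P m = P_min" using P_min_attained by blast
  have "thr_above \<kappa> v K m = 0" unfolding thr_above_def using assms(1) m by (cases "K = 0") auto
  then have "T m \<le> 0" using assms(2) used_le_M m(1) by metis
  then have "(\<Sum>m = 1..M. \<eta> m * 0) < serve T 0"
    unfolding serve_def using m(1) by (intro sum_used_strict_mono[of _ _ m]) auto
  then show ?thesis by simp
qed

lemma crit_le_P_max: "net \<kappa> v i \<le> mean_P \<Longrightarrow> crit \<kappa> v i \<le> P_max"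
  by (simp add: crit_def critical)

lemma serve_less_1:
  assumes "m \<in> used" "i < T m" shows "serve T i < 1"
proof -
  have "serve T i < (\<Sum>m = 1..M. \<eta> m * 1)"
    unfolding serve_def using assms by (intro sum_used_strict_mono[of _ _ m]) auto
  then show ?thesis using eta_sum by simp
qed

text \<open>At the first level \<open>k\<close> where the recursion has no solution, the threshold
  policy that follows the prices below \<open>k\<close> and always transmits at \<open>k\<close> has
  a Lagrangian value below \<open>v\<close>.\<close>

lemma net_le_mean_P:
  assumes "0 \<le> \<kappa>" "P_min < P_max"
    and opt: "\<And>z. admissible z \<Longrightarrow> finite_mean z \<Longrightarrow> v \<le> total_energy z + \<kappa> * mean_queue z"
  shows "enat k < Q \<Longrightarrow> net \<kappa> v k \<le> mean_P"
proof (induction k rule: less_induct)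
  case (less k)
  have net: "net \<kappa> v i \<le> mean_P" if "i < k" for i
    using less.IH[OF that] less.prems that by (metis enat_ord_simps(2) order_less_trans)
  show ?case
  proof (rule ccontr)
    assume "\<not> net \<kappa> v k \<le> mean_P"
    then have big: "mean_P < net \<kappa> v k" by simp
    note inc = crit_increasing[OF assms(1,2) net less_imp_le[OF big]]
    define T where "T = thr_above \<kappa> v k"
    have T: "T m \<le> k" for m by (simp add: T_def thr_capped)
    have T_iff: "T m \<le> i \<longleftrightarrow> P m < crit \<kappa> v i" if "i < k" for m i
      unfolding T_def using inc(2) that by (intro thr_iff) auto
    have s0: "0 < serve T 0" using inc(1) by (intro serve_0_pos[of k \<kappa> v]) (auto simp: T_def)
    have "P m \<le> crit \<kappa> v i" if "i < k" "T m \<le> i" for i m using T_iff that by force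
    moreover have "crit \<kappa> v i \<le> P m" if "i < k" "i < T m" for i m using T_iff[of i m] that by force
    ultimately have "total_energy (thr_policy T) + \<kappa> * mean_queue (thr_policy T) - v
        = qp (thr_policy T) k * (mean_P - net \<kappa> v k)"
      using T less.prems s0 net by (intro thr_policy_lagrangian) auto
    \<comment> \<open>No price exceeds \<open>P_max\<close>, so below \<open>k\<close> a dearest
      channel is silent. Hence level \<open>k\<close> is reached with positive probability and the
      gain is strict.\<close>
    moreover have "serve T i < 1" if "i < k" for i
    proof -
      obtain m where m: "m \<in> used" "P m = P_max" using P_max_attained by blast
      have "i < T m" using T_iff[OF that, of m] crit_le_P_max[OF net[OF that]] m by force
      then show ?thesis using m serve_less_1 by blast
    qed
    then have "0 < qp (thr_policy T) k"
      using thr_dist_pos[of T k k] qp_thr_policy[of T k k] T less.prems s0 by simp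
    ultimately have "total_energy (thr_policy T) + \<kappa> * mean_queue (thr_policy T) < v"
      using big by (smt (verit) mult_pos_neg)
    moreover have "admissible (thr_policy T)" "finite_mean (thr_policy T)"
      using T less.prems s0 thr_policy_admissible[of T k] bounded_support(1)[of "thr_policy T" k]
        thr_policy_support[of T k] by auto
    ultimately show False using opt by fastforce
  qed
qed

text \<open>The Lagrangian series sums to 0, and its partial sums are sums of nonnegative slacks
  minus a boundary term. That term is 0 at the end of a finite buffer and tends to 0 for an infinite
  one.\<close>

lemma optimal_slack_eq_0:
  assumes y: "admissible y" "finite_mean y"
    and v: "total_energy y + \<kappa> * mean_queue y = v"
    and net: "\<And>i. enat i < Q \<Longrightarrow> net \<kappa> v i \<le> mean_P"
    and i: "enat i < Q"
  shows "slack (crit \<kappa> v i) y i = 0"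
proof -
  let ?L = "\<lambda>i. (\<kappa> * real i - v) * qp y i + energy y i"
  let ?s = "\<lambda>i. slack (crit \<kappa> v i) y i"
  have L: "?L sums 0" using lagrangian_sums[OF y, of \<kappa> v] v by simp
  show ?thesis
  proof (cases Q)
    case (enat q)
    have "?L i = 0" if "i \<ge> q" for i
      using that enat admissibleD(6)[OF y(1), of i] energy_bound[OF y(1), of i] by simp
    then have "?L sums (\<Sum>i<q. ?L i)" by (intro sums_finite) auto
    then have "(\<Sum>i<q. ?L i) = 0" using L sums_unique2 by blast
    moreover have "(\<Sum>i<q. ?L i) = (\<Sum>i<q. ?s i) - qp y q * (net \<kappa> v q - v + \<kappa> * real q)"
      using net enat by (intro partial_lagrangian) auto
    moreover have "qp y q = 0" using admissibleD(6)[OF y(1)] enat by simp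
    ultimately have "(\<Sum>i<q. ?s i) = 0" by simp
    then show ?thesis using slack_nonneg[OF y(1)] i enat
      by (subst (asm) sum_nonneg_eq_0_iff) auto
  next
    case infinity
    then have net': "net \<kappa> v i \<le> mean_P" for i using net by simp
    \<comment> \<open>Prices stay below \<open>P_max\<close>, which bounds the boundary term by a
      fixed multiple of \<open>qp y (Suc n)\<close>.\<close>
    have "?s i \<le> (\<Sum>j<Suc n. ?L j) + qp y (Suc n) * (\<xi> * surplus P_max)" if "i \<le> n" for n
    proof -
      have "(\<Sum>j<Suc n. ?L j) = (\<Sum>j<Suc n. ?s j) - qp y (Suc n) * (\<xi> * surplus (crit \<kappa> v n))"
        using partial_lagrangian[of "Suc n" \<kappa> v y] net' by (simp add: crit_def)
      moreover have "qp y (Suc n) * (\<xi> * surplus (crit \<kappa> v n)) \<le> qp y (Suc n) * (\<xi> * surplus P_max)"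
        using xi_pos admissibleD(5)[OF y(1)] net'
        by (intro mult_left_mono surplus_mono crit_le_P_max) auto
      moreover have "?s i \<le> (\<Sum>j<Suc n. ?s j)"
        using slack_nonneg[OF y(1)] that by (intro member_le_sum) auto
      ultimately show ?thesis by simp
    qed
    moreover have "(\<lambda>n. (\<Sum>j<Suc n. ?L j) + qp y (Suc n) * (\<xi> * surplus P_max))
        \<longlonglongrightarrow> 0 + 0 * (\<xi> * surplus P_max)"
    proof (intro tendsto_add tendsto_mult tendsto_const)
      show "(\<lambda>n. \<Sum>j<Suc n. ?L j) \<longlonglongrightarrow> 0" using L unfolding sums_def by (rule LIMSEQ_Suc)
      show "(\<lambda>n. qp y (Suc n)) \<longlonglongrightarrow> 0"
        using admissibleD(3)[OF y(1)] by (intro LIMSEQ_Suc summable_LIMSEQ_zero) (simp add: sums_iff)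
    qed
    ultimately have "?s i \<le> 0 + 0 * (\<xi> * surplus P_max)"
      by (intro tendsto_lowerbound[where F = sequentially]) (auto simp: eventually_sequentially)
    then show ?thesis using slack_nonneg[OF y(1), of "crit \<kappa> v i" i] by simp
  qed
qed

lemma net_small_crit:
  assumes "r \<le> mean_P" "r < P_min" shows "critical r < P_min"
proof (rule ccontr)
  assume "\<not> critical r < P_min"
  then have "(\<Sum>m = 1..M. \<eta> m * P_min) \<le> critical r - surplus (critical r)"
    unfolding diff_surplus using P_bounds(1) by (intro sum_used_mono) auto
  then show False using assms critical[OF assms(1)] eta_sum by (simp flip: sum_distrib_right)
qed

text \<open>For an infinite buffer, \<open>\<kappa> > 0\<close> makes \<open>net\<close> fall below
  \<open>P_min\<close>, as the surplus is bounded by that of \<open>P_max\<close>. Then the price is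
  below every power and complementary slackness leaves the level empty.\<close>

lemma optimal_bounded_support:
  assumes y: "admissible y" "finite_mean y"
    and v: "total_energy y + \<kappa> * mean_queue y = v"
    and net: "\<And>i. enat i < Q \<Longrightarrow> net \<kappa> v i \<le> mean_P"
    and k: "Q = \<infinity> \<Longrightarrow> 0 < \<kappa>"
  shows "\<exists>N. \<forall>i\<ge>N. qp y i = 0"
proof (cases Q)
  case (enat q)
  then show ?thesis using admissibleD(6)[OF y(1)] by auto
next
  case infinity
  then have net': "net \<kappa> v i \<le> mean_P" for i using net by simp
  obtain N where N: "v + \<xi> * surplus P_max - P_min < real N * \<kappa>"
    using ex_less_of_nat_mult[of \<kappa>] k infinity by blast
  have "qp y i = 0" if i: "Suc N \<le> i" for i
  proof -
    obtain j where j: "i = Suc j" using i by (cases i) auto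
    have "\<xi> * surplus (crit \<kappa> v j) \<le> \<xi> * surplus P_max"
      using xi_pos net' by (intro mult_left_mono surplus_mono crit_le_P_max) auto
    moreover have "real N * \<kappa> \<le> \<kappa> * real i" using i k infinity by (simp add: mult.commute)
    ultimately have "net \<kappa> v i < P_min" using N j by (simp add: crit_def)
    then have c: "crit \<kappa> v i < P_min" using net_small_crit net' by (simp add: crit_def)
    have s: "slack (crit \<kappa> v i) y i = 0"
      using optimal_slack_eq_0[OF y v net] infinity by simp
    have "y i m = 0" if "m \<in> used" for m
      using slack_eq_0D(1)[OF y(1) s that] c P_bounds(1)[OF that] by simp
    then show ?thesis unfolding queue_prob_def by (subst sum_used_cong[of _ "\<lambda>_. 0"]) auto
  qed
  then show ?thesis by blast
qed

text \<open>At each level below \<open>K\<close> the policy serves at least the fraction of the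
  upper bound that \<open>y\<close> serves, so its ratio of successive probabilities is at most that
  of \<open>y\<close>, and the likelihood ratio bound applies.\<close>

lemma thr_mean_le:
  assumes T: "\<And>m. m \<in> {1..M} \<Longrightarrow> T m \<le> K" and K: "enat K < Q" and s0: "0 < serve T 0"
    and y: "admissible y" "\<And>i. K < i \<Longrightarrow> qp y i = 0" "\<And>i. i \<le> K \<Longrightarrow> 0 < qp y i"
    and le: "\<And>i. i < K \<Longrightarrow> qp y i \<le> serve T i * ub y i"
  shows "mean_queue (thr_policy T) \<le> mean_queue y"
proof -
  note adm = thr_policy_admissible[OF T K s0] and sup = thr_policy_support[OF T K s0]
  have qp: "qp (thr_policy T) i = thr_dist T i" for i using qp_thr_policy[OF T K s0] by simp
  have "qp (thr_policy T) (Suc i) * qp y i \<le> qp y (Suc i) * qp (thr_policy T) i" if i: "i < K" for i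
  proof -
    let ?a = "qp (thr_policy T)" and ?b = "qp y" and ?s = "serve T i"
    have s: "0 < ?s * \<xi>" using s0 serve_mono[of 0 i T] xi_pos by simp
    have a: "(1 - ?s) * ?a i = ?s * \<xi> * ?a (Suc i)"
      using thr_dist_props(4)[OF T K s0, of i] unfolding qp by (simp add: algebra_simps)
    have b: "(1 - ?s) * ?b i \<le> ?s * \<xi> * ?b (Suc i)"
      using le[OF i] by (simp add: upper_bound_def algebra_simps)
    have "(?s * \<xi>) * (?a (Suc i) * ?b i) = ?b i * (?s * \<xi> * ?a (Suc i))" by simp
    also have "\<dots> = ?a i * ((1 - ?s) * ?b i)" unfolding a[symmetric] by simp
    also have "\<dots> \<le> ?a i * (?s * \<xi> * ?b (Suc i))"
      using b admissibleD(5)[OF adm] by (rule mult_left_mono)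
    also have "\<dots> = (?s * \<xi>) * (?b (Suc i) * ?a i)" by simp
    finally show ?thesis using s by (simp only: mult_le_cancel_left_pos)
  qed
  then show ?thesis
    using bounded_support[OF adm sup] bounded_support[OF y(1,2)] y(3)
      likelihood_ratio_mean_le[of K "qp y" "qp (thr_policy T)"] by simp
qed

text \<open>The mirror image of \<open>thr_mean_le\<close>. The positive distribution required by
  the likelihood ratio bound is now that of the policy, which is why \<open>serve T i < 1\<close> is
  assumed.\<close>

lemma thr_mean_ge:
  assumes T: "\<And>m. m \<in> {1..M} \<Longrightarrow> T m \<le> K" and K: "enat K < Q" and s0: "0 < serve T 0"
    and y: "admissible y" "\<And>i. K < i \<Longrightarrow> qp y i = 0"
    and less: "\<And>i. i < K \<Longrightarrow> serve T i < 1"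
    and ge: "\<And>i. i < K \<Longrightarrow> serve T i * ub y i \<le> qp y i"
  shows "mean_queue y \<le> mean_queue (thr_policy T)"
proof -
  note adm = thr_policy_admissible[OF T K s0] and sup = thr_policy_support[OF T K s0]
  have qp: "qp (thr_policy T) i = thr_dist T i" for i using qp_thr_policy[OF T K s0] by simp
  have "qp y (Suc i) * qp (thr_policy T) i \<le> qp (thr_policy T) (Suc i) * qp y i" if i: "i < K" for i
  proof -
    let ?a = "qp (thr_policy T)" and ?b = "qp y" and ?s = "serve T i"
    have s: "0 < ?s * \<xi>" using s0 serve_mono[of 0 i T] xi_pos by simp
    have a: "(1 - ?s) * ?a i = ?s * \<xi> * ?a (Suc i)"
      using thr_dist_props(4)[OF T K s0, of i] unfolding qp by (simp add: algebra_simps)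
    have b: "?s * \<xi> * ?b (Suc i) \<le> (1 - ?s) * ?b i"
      using ge[OF i] by (simp add: upper_bound_def algebra_simps)
    have "(?s * \<xi>) * (?b (Suc i) * ?a i) = ?a i * (?s * \<xi> * ?b (Suc i))" by simp
    also have "\<dots> \<le> ?a i * ((1 - ?s) * ?b i)"
      using b admissibleD(5)[OF adm] by (rule mult_left_mono)
    also have "\<dots> = ?b i * ((1 - ?s) * ?a i)" by simp
    also have "\<dots> = (?s * \<xi>) * (?a (Suc i) * ?b i)" unfolding a by simp
    finally show ?thesis using s by (simp only: mult_le_cancel_left_pos)
  qed
  moreover have "0 < qp (thr_policy T) i" if "i \<le> K" for i
    using thr_dist_pos[OF T K s0 that less] unfolding qp .
  ultimately show ?thesis
    using bounded_support[OF adm sup] bounded_support[OF y(1,2)]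
      likelihood_ratio_mean_le[of K "qp (thr_policy T)" "qp y"] by simp
qed

subsection \<open>Minimisers of the Lagrangian\<close>

lemma M_ge_2: assumes "P_min < P_max" shows "M \<ge> 2"
proof (rule ccontr)
  assume "\<not> M \<ge> 2"
  then have "used \<subseteq> {1}" using M_pos by (auto simp: used_def)
  then have "P_min = P 1" "P_max = P 1" using P_min_attained P_max_attained by auto
  then show False using assms by simp
qed

text \<open>The point obtained need not be \<open>y\<close>; it is a mixture of two neighbours in
  the chain of policies. As the chain has constant Lagrangian value, matching the mean queue length
  of \<open>y\<close> matches its energy too, also for \<open>\<kappa> = 0\<close>.\<close>

lemma lagrangian_minimiser_threshold:
  assumes y: "admissible y" "finite_mean y" and kappa: "0 \<le> \<kappa>" "Q = \<infinity> \<Longrightarrow> 0 < \<kappa>"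
    and P: "P_min < P_max"
    and opt: "\<And>z. admissible z \<Longrightarrow> finite_mean z \<Longrightarrow>
      total_energy y + \<kappa> * mean_queue y \<le> total_energy z + \<kappa> * mean_queue z"
  shows "\<exists>z thr. admissible z \<and> finite_mean z \<and> mean_queue z = mean_queue y \<and>
    total_energy z = total_energy y \<and>
    threshold_structure M \<alpha> \<eta> Q thr z \<and> (\<forall>m. thr m \<noteq> \<infinity>)"
proof -
  define v where "v = total_energy y + \<kappa> * mean_queue y"
  let ?c = "crit \<kappa> v"
  have net: "net \<kappa> v i \<le> mean_P" if "enat i < Q" for i
    using net_le_mean_P[OF kappa(1) P, of v i] opt that by (simp add: v_def)
  have slack0: "slack (?c i) y i = 0" if "enat i < Q" for i
    using that by (intro optimal_slack_eq_0[OF y _ net]) (simp_all add: v_def)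
  obtain N where N: "\<forall>i\<ge>N. qp y i = 0"
    using optimal_bounded_support[OF y _ net kappa(2)] by (auto simp: v_def)
  define K where "K = Max {i. qp y i \<noteq> 0}"
  have fin: "finite {i. qp y i \<noteq> 0}"
  proof (rule finite_subset)
    show "{i. qp y i \<noteq> 0} \<subseteq> {..<N}" using N by (auto simp: not_less intro: ccontr)
  qed simp
  have "{i. qp y i \<noteq> 0} \<noteq> {}"
  proof
    assume "{i. qp y i \<noteq> 0} = {}"
    then have "qp y = (\<lambda>_. 0)" by auto
    then show False using admissibleD(3)[OF y(1)] by (simp add: sums_iff)
  qed
  then have "qp y K \<noteq> 0" using Max_in[OF fin] by (simp add: K_def)
  then have qK: "0 < qp y K" using admissibleD(5)[OF y(1), of K] by simp
  have sup: "qp y i = 0" if "K < i" for i using Max_ge[OF fin, of i] that by (force simp: K_def)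
  have KQ: "enat K < Q" using admissibleD(6)[OF y(1), of K] qK by (metis less_irrefl not_le)
  have iQ: "enat i < Q" if "i \<le> K" for i using that KQ by (metis enat_ord_simps(1) order_le_less_trans)
  have ubK: "ub y K = qp y K" using sup[of "Suc K"] by (simp add: upper_bound_def)
  \<comment> \<open>At the last occupied level \<open>ub y K = qp y K\<close>, so all channels of
    positive probability transmit fully. A price below \<open>P_max\<close> would silence a dearest
    one.\<close>
  have "P_max \<le> ?c K"
  proof (rule ccontr)
    assume c: "\<not> P_max \<le> ?c K"
    obtain m where m: "m \<in> used" "P m = P_max" using P_max_attained by blast
    have "(\<Sum>m = 1..M. \<eta> m * (ub y K - y K m)) = ub y K * (\<Sum>m = 1..M. \<eta> m) - qp y K"
      by (simp add: queue_prob_def sum_distrib_left sum_subtractf algebra_simps)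
    then have "(\<Sum>m = 1..M. \<eta> m * (ub y K - y K m)) = 0" using ubK eta_sum by simp
    then have "ub y K - y K m = 0"
      using m admissibleD(2)[OF y(1) used_le_M]
      by (intro sum_used_eq_0[where f = "\<lambda>m. ub y K - y K m"]) auto
    moreover have "y K m = 0" using slack_eq_0D(1)[OF y(1) slack0[OF KQ] m(1)] c m by simp
    ultimately show False using ubK qK by simp
  qed
  then have netK: "mean_P \<le> net \<kappa> v K"
    using diff_surplus_P_max[of "?c K"] critical[OF net[OF KQ]] by (simp add: crit_def)
  note inc = crit_increasing[OF kappa(1) P net[OF iQ[OF less_imp_le]] netK]
  define A where "A = thr_above \<kappa> v K"
  define B where "B = thr_below \<kappa> v K"
  have AK: "A m \<le> K" and BK: "B m \<le> K" for m by (simp_all add: A_def B_def thr_capped)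
  have A_iff: "A m \<le> i \<longleftrightarrow> P m < ?c i" and B_iff: "B m \<le> i \<longleftrightarrow> P m \<le> ?c i" if "i < K" for i m
    unfolding A_def B_def using thr_iff[of K \<kappa> v i m] inc(2) that by auto
  have BA: "B m \<le> A m" for m
    using B_iff[of "A m" m] A_iff[of "A m" m] BK[of m] AK[of m] by (cases "A m < K") force+
  \<comment> \<open>Strictly increasing prices meet \<open>P m\<close> at one level at most, so the
    two decisions differ by at most one level.\<close>
  have AB: "A m \<le> Suc (B m)" for m
  proof (cases "Suc (B m) < K")
    case True
    then have "P m \<le> ?c (B m)" using B_iff[of "B m" m] by simp
    also have "\<dots> < ?c (Suc (B m))" using inc(2) True by simp
    finally show ?thesis using A_iff[OF True] by simp
  next
    case False then show ?thesis using AK[of m] by simp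
  qed
  have A_mono: "A m \<le> A m'" and B_mono: "B m \<le> B m'" if "m \<in> {1..M}" "m' \<in> {1..M}" "m \<le> m'" for m m'
  proof -
    have P': "P m \<le> P m'" using mono_onD[OF P_mono] that by blast
    show "A m \<le> A m'"
      using A_iff[of "A m'"] AK[of m] AK[of m'] P'
      by (cases "A m' < K") (auto intro: le_less_trans)
    show "B m \<le> B m'"
      using B_iff[of "B m'"] BK[of m] BK[of m'] P'
      by (cases "B m' < K") (auto intro: order_trans)
  qed
  have A1: "A 1 = 0"
    using A_iff[of 0 1] inc(1) P_1_le AK[of 1] by (cases "K = 0") auto
  \<comment> \<open>The chain of policies: channels before \<open>j\<close> transmit at a tie, the
    others do not. The condition \<open>1 \<le> m\<close> makes \<open>T 1\<close> equal to
    \<open>A\<close> as a function.\<close>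
  define T where "T j m = (if 1 \<le> m \<and> m < j then B m else A m)" for j m
  have TK: "T j m \<le> K" and TA: "T j m \<le> A m" and BT: "B m \<le> T j m" for j m
    using AK BK BA by (auto simp: T_def)
  have s0: "0 < serve (T j) 0" for j
    using inc(1) TA by (intro serve_0_pos[of K \<kappa> v]) (auto simp: A_def)
  have T1: "T 1 = A" by (auto simp: T_def fun_eq_iff)
  have TM: "T (Suc M) m = B m" if "m \<in> {1..M}" for m using that by (auto simp: T_def)
  have pol: "admissible (thr_policy (T j))" "finite_mean (thr_policy (T j))"
    "thr_policy (T j) i m = (if T j m \<le> i then ub (thr_policy (T j)) i else 0)"
    "total_energy (thr_policy (T j)) + \<kappa> * mean_queue (thr_policy (T j)) = v" for j i m
  proof -
    show adm: "admissible (thr_policy (T j))" using thr_policy_admissible[OF TK KQ s0] by simp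
    show "finite_mean (thr_policy (T j))"
      by (rule bounded_support(1)[OF adm, of K]) (use thr_policy_support[OF TK KQ s0] in simp)
    show "thr_policy (T j) i m = (if T j m \<le> i then ub (thr_policy (T j)) i else 0)"
      using thr_policy_eq[OF TK KQ s0] by simp
    have "P m \<le> ?c i" if "i < K" "T j m \<le> i" for i m
      using B_iff[OF that(1), of m] BT[of m j] that by simp
    moreover have "?c i \<le> P m" if "i < K" "i < T j m" for i m
      using A_iff[OF that(1), of m] TA[of j m] that by force
    ultimately have "total_energy (thr_policy (T j)) + \<kappa> * mean_queue (thr_policy (T j)) - v
        = qp (thr_policy (T j)) K * (mean_P - net \<kappa> v K)"
      using net iQ TK KQ s0 by (intro thr_policy_lagrangian) auto
    then show "total_energy (thr_policy (T j)) + \<kappa> * mean_queue (thr_policy (T j)) = v"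
      using netK net[OF KQ] by simp
  qed
  \<comment> \<open>By complementary slackness, \<open>y\<close> serves at least as much as
    \<open>A\<close> and at most as much as \<open>B\<close>, which places its mean queue length
    between those of the ends of the chain.\<close>
  have serve_ub: "serve T' i * ub y i = (\<Sum>m = 1..M. \<eta> m * (if T' m \<le> i then ub y i else 0))" for T' i
    unfolding serve_def sum_distrib_right by (intro sum.cong) auto
  have qp_ge: "serve A i * ub y i \<le> qp y i" if i: "i < K" for i
    unfolding serve_ub queue_prob_def
    using slack_eq_0D(2)[OF y(1) slack0[OF iQ[OF less_imp_le[OF i]]]] A_iff[OF i] admissibleD(1)[OF y(1) used_le_M]
    by (intro sum_used_mono) auto
  have qp_le: "qp y i \<le> serve (T (Suc M)) i * ub y i" if i: "i < K" for i
    unfolding serve_ub queue_prob_def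
  proof (rule sum_used_mono)
    fix m assume m: "m \<in> used"
    show "y i m \<le> (if T (Suc M) m \<le> i then ub y i else 0)"
      using slack_eq_0D(1)[OF y(1) slack0[OF iQ[OF less_imp_le[OF i]]] m] B_iff[OF i, of m]
        admissibleD(2)[OF y(1) used_le_M[OF m]] TM[OF used_le_M[OF m]] by auto
  qed
  have pos: "0 < qp y i" if "i \<le> K" for i
    using that
  proof (induction i rule: inc_induct)
    case (step i)
    have "0 < serve A i" using s0[of 1] serve_mono[of 0 i A] T1 by simp
    moreover have "0 < ub y i"
      using step.IH xi_pos admissibleD(5)[OF y(1), of i]
      by (simp add: upper_bound_def add_nonneg_pos)
    ultimately have "0 < serve A i * ub y i" by simp
    then show ?case using qp_ge[of i] step.hyps by simp
  qed (rule qK)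
  define f where "f j = mean_queue (thr_policy (T j))" for j
  have f1: "mean_queue y \<le> f 1"
    unfolding f_def
  proof (rule thr_mean_ge[OF TK KQ s0 y(1) sup])
    obtain m where m: "m \<in> used" "P m = P_max" using P_max_attained by blast
    fix i assume i: "i < K"
    have "i < A m" using A_iff[OF i, of m] crit_le_P_max[OF net[OF iQ[OF less_imp_le[OF i]]]] m by force
    then show "serve (T 1) i < 1" using serve_less_1 m T1 by simp
    show "serve (T 1) i * ub y i \<le> qp y i" using qp_ge[OF i] T1 by simp
  qed auto
  have fM: "f (Suc M) \<le> mean_queue y"
    unfolding f_def by (rule thr_mean_le[OF TK KQ s0 y(1) sup pos qp_le]) auto
  \<comment> \<open>A discrete intermediate value argument: the first descent to or below
    \<open>mean_queue y\<close> is taken, without monotonicity of \<open>f\<close>. The shift by two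
    in the least index ensures \<open>1 \<le> j\<close>.\<close>
  obtain j where j: "1 \<le> j" "j \<le> M" "mean_queue y \<le> f j" "f (Suc j) \<le> mean_queue y"
  proof -
    define n where "n = (LEAST n. f (Suc (Suc n)) \<le> mean_queue y)"
    have ex: "f (Suc (Suc (M - 1))) \<le> mean_queue y" using fM M_pos by simp
    have n: "f (Suc (Suc n)) \<le> mean_queue y" "n \<le> M - 1"
      unfolding n_def using ex by (rule LeastI, rule Least_le)
    have "mean_queue y \<le> f (Suc n)"
    proof (cases n)
      case 0 then show ?thesis using f1 by simp
    next
      case (Suc k)
      then have "\<not> f (Suc (Suc k)) \<le> mean_queue y"
        unfolding n_def by (intro not_less_Least) simp
      then show ?thesis using Suc by simp
    qed
    then show ?thesis using that[of "Suc n"] n M_pos by simp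
  qed
  have "\<exists>t. 0 \<le> t \<and> t \<le> 1 \<and> (1 - t) * f j + t * f (Suc j) = mean_queue y"
  proof (cases "f j = f (Suc j)")
    case True
    then show ?thesis using j by (intro exI[of _ 0]) auto
  next
    case False
    then have d: "0 < f j - f (Suc j)" using j by simp
    define t where "t = (f j - mean_queue y) / (f j - f (Suc j))"
    have "t * (f j - f (Suc j)) = f j - mean_queue y" using d by (simp add: t_def)
    moreover have "0 \<le> t" "t \<le> 1" using d j by (auto simp: t_def)
    ultimately show ?thesis by (intro exI[of _ t]) (auto simp: algebra_simps)
  qed
  then obtain t where t: "0 \<le> t" "t \<le> 1" "(1 - t) * f j + t * f (Suc j) = mean_queue y" by blast
  define z where "z = (\<lambda>i m. (1 - t) * thr_policy (T j) i m + t * thr_policy (T (Suc j)) i m)"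
  have z: "admissible z" "finite_mean z"
    unfolding z_def using pol(1,2) t by (auto intro!: admissible_convex mean_lincomb(1))
  have Dz: "mean_queue z = mean_queue y"
    unfolding z_def using mean_lincomb(2) pol(2) t(3) by (simp add: f_def)
  have E: "total_energy (thr_policy (T j)) = v - \<kappa> * f j" for j
    using pol(4)[of j] by (simp add: f_def)
  have "total_energy z = (1 - t) * (v - \<kappa> * f j) + t * (v - \<kappa> * f (Suc j))"
    unfolding z_def using total_energy_lincomb[OF pol(1) pol(1)] E by simp
  also have "\<dots> = v - \<kappa> * ((1 - t) * f j + t * f (Suc j))" by (simp add: algebra_simps)
  finally have Ez: "total_energy z = total_energy y" unfolding t(3) by (simp add: v_def)
  have zon: "z i m = ub z i" if "T j m \<le> i" for i m
  proof -
    have "T (Suc j) m \<le> i" using that BA[of m] by (auto simp: T_def split: if_splits)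
    then show ?thesis using that pol(3)[of j i m] pol(3)[of "Suc j" i m]
      by (simp add: z_def ub_lincomb)
  qed
  have zoff: "z i m = 0" if "i < T (Suc j) m" for i m
  proof -
    have "i < T j m" using that BA[of m] by (auto simp: T_def split: if_splits)
    then show ?thesis using that pol(3)[of j i m] pol(3)[of "Suc j" i m]
      by (simp add: z_def)
  qed
  have T_step: "T j m \<le> Suc (T (Suc j) m)" for m using AB[of m] by (auto simp: T_def)
  have T_off: "T (Suc j) m = T j m" if "m \<noteq> j" for m using that by (auto simp: T_def)
  \<comment> \<open>The later thresholds \<open>T j\<close> are used. The two policies mixed differ
    in channel \<open>j\<close> only, and there by at most one level, so a partial transmission can
    occur only just below \<open>T j j\<close>.\<close>
  have "threshold_structure M \<alpha> \<eta> Q (\<lambda>m. enat (T j m)) z"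
    unfolding threshold_structure_def
  proof (intro conjI ballI impI)
    show "enat (T j 1) = 0" using TA[of j 1] A1 by (simp add: zero_enat_def)
    show "mono_on {1..M} (\<lambda>m. enat (T j m))"
    proof (rule mono_onI)
      fix m m' assume m: "m \<in> {1..M}" "m' \<in> {1..M}" "m \<le> m'"
      show "enat (T j m) \<le> enat (T j m')"
        using A_mono[OF m] B_mono[OF m] BA[of m'] m by (auto simp: T_def)
    qed
    show "enat (T j m) \<le> Q" for m using iQ[OF TK] by (simp add: less_imp_le)
    show "z i m = 0" if "enat (i + 1) < enat (T j m)" for i m
      using that T_step[of m] by (intro zoff) simp
    show "z i m = ub z i" if "enat (T j m) \<le> enat i" for i m using that by (intro zon) simp
    \<comment> \<open>For \<open>j = 1\<close> no channel from 2 on is undecided, and 2 merely fills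
      the place.\<close>
    let ?mt = "max 2 j"
    show "\<exists>mt\<in>{2..M}. \<forall>m\<in>{2..M} - {mt}. \<forall>i. enat (T j m) = enat (i + 1) \<longrightarrow> z i m = 0"
    proof (rule bexI[of _ ?mt], intro ballI allI impI)
      fix m i assume "m \<in> {2..M} - {?mt}" "enat (T j m) = enat (i + 1)"
      then show "z i m = 0" using T_off[of m] by (intro zoff) (auto simp: max_def split: if_splits)
    qed (use M_ge_2[OF P] j in auto)
  qed
  then show ?thesis using z Dz Ez by blast
qed

text \<open>The multiplier is the supremum of the energy saved per unit of additional queue length,
  over the points with less energy than \<open>y\<close>. Convexity keeps these slopes below those
  on the other side of \<open>y\<close>.\<close>

lemma multiplier_exists:
  assumes y: "admissible y" "finite_mean y" "0 < mean_queue y"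
    and low: "total_energy y < mean_P"
    and opt: "\<And>z. admissible z \<Longrightarrow> finite_mean z \<Longrightarrow> total_energy z \<le> total_energy y \<Longrightarrow>
      mean_queue y \<le> mean_queue z"
  shows "\<exists>\<kappa>\<ge>0. (\<forall>z. admissible z \<longrightarrow> finite_mean z \<longrightarrow>
      total_energy y + \<kappa> * mean_queue y \<le> total_energy z + \<kappa> * mean_queue z) \<and>
    ((\<exists>z. admissible z \<and> finite_mean z \<and> total_energy z < total_energy y) \<longrightarrow> 0 < \<kappa>)"
proof -
  let ?E = "total_energy y" and ?D = "mean_queue y"
  define L where "L = {z. admissible z \<and> finite_mean z \<and> total_energy z < ?E}"
  \<comment> \<open>The element 0 makes \<open>S\<close> nonempty and its supremum
    nonnegative.\<close>
  define S where "S = insert 0 ((\<lambda>z. (?E - total_energy z) / (mean_queue z - ?D)) ` L)"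
  have cross: "?D * (total_energy w - total_energy z) \<le>
      (total_energy w - ?E) * mean_queue z + (?E - total_energy z) * mean_queue w"
    if z: "z \<in> L" and w: "admissible w" "finite_mean w" "?E \<le> total_energy w" for z w
  proof -
    have z': "admissible z" "finite_mean z" "total_energy z < ?E" using z by (auto simp: L_def)
    define d where "d = total_energy w - total_energy z"
    have d: "0 < d" using z' w by (simp add: d_def)
    \<comment> \<open>With these weights the mixture of \<open>z\<close> and \<open>w\<close> has
      exactly the energy of \<open>y\<close>, so that optimality of \<open>y\<close> applies to
      it.\<close>
    define a where "a = (total_energy w - ?E) / d"
    define b where "b = (?E - total_energy z) / d"
    have ab: "0 \<le> a" "0 \<le> b" "a + b = 1"
      using d z' w by (auto simp: a_def b_def d_def add_divide_distrib[symmetric])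
    let ?u = "\<lambda>i m. a * z i m + b * w i m"
    have "total_energy ?u = a * total_energy z + b * total_energy w"
      using z' w by (intro total_energy_lincomb)
    also have "\<dots> = ((total_energy w - ?E) * total_energy z + (?E - total_energy z) * total_energy w) / d"
      by (simp add: a_def b_def add_divide_distrib)
    also have "(total_energy w - ?E) * total_energy z + (?E - total_energy z) * total_energy w = ?E * d"
      by (simp add: d_def algebra_simps)
    finally have "total_energy ?u = ?E" using d by simp
    then have "?D \<le> mean_queue ?u"
      using ab z' w by (intro opt admissible_convex mean_lincomb(1)) auto
    also have "\<dots> = a * mean_queue z + b * mean_queue w" by (rule mean_lincomb(2)[OF z'(2) w(2)])
    also have "\<dots> = ((total_energy w - ?E) * mean_queue z + (?E - total_energy z) * mean_queue w) / d"
      by (simp add: a_def b_def add_divide_distrib)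
    finally have "?D * d \<le> (total_energy w - ?E) * mean_queue z + (?E - total_energy z) * mean_queue w"
      using d by (simp add: pos_le_divide_eq)
    then show ?thesis by (simp add: d_def)
  qed
  \<comment> \<open>Transmitting always keeps the queue empty at energy \<open>mean_P\<close>. This
    point bounds the slopes and shows that their denominators are positive.\<close>
  let ?greedy = "thr_policy (\<lambda>_. 0)"
  have T0: "(0::nat) \<le> 0" "enat 0 < Q" "0 < serve (\<lambda>_. 0) 0"
    using Q_pos eta_sum by (auto simp: zero_enat_def serve_def)
  have greedy: "admissible ?greedy" "finite_mean ?greedy" "mean_queue ?greedy = 0" "total_energy ?greedy = mean_P"
  proof -
    have sup: "qp ?greedy i = 0" if "0 < i" for i
      using thr_policy_support[of "\<lambda>_. 0" 0] T0 that by simp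
    show adm: "admissible ?greedy" using thr_policy_admissible[of "\<lambda>_. 0" 0] T0 by simp
    show "finite_mean ?greedy" by (rule bounded_support(1)[OF adm sup])
    have "mean_queue ?greedy = (\<Sum>i\<le>0. real i * qp ?greedy i)" by (rule bounded_support(2)[OF adm sup])
    then show "mean_queue ?greedy = 0" by simp
    have "total_energy ?greedy + 0 * mean_queue ?greedy - mean_P = qp ?greedy 0 * (mean_P - net 0 mean_P 0)"
      by (rule thr_policy_lagrangian) (use T0 in simp_all)
    then show "total_energy ?greedy = mean_P" by simp
  qed
  have gap: "?D < mean_queue z" if z: "z \<in> L" for z
  proof -
    have "?D * (mean_P - total_energy z) \<le> (mean_P - ?E) * mean_queue z"
      using cross[OF z greedy(1,2)] low greedy by simp
    moreover have "?D * (mean_P - ?E) < ?D * (mean_P - total_energy z)"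
      using y z by (auto simp: L_def)
    ultimately have "(mean_P - ?E) * ?D < (mean_P - ?E) * mean_queue z" by (simp add: mult.commute)
    then show ?thesis using low by simp
  qed
  have bdd: "s * (?D - mean_queue w) \<le> total_energy w - ?E"
    if "s \<in> S" "admissible w" "finite_mean w" "?E \<le> total_energy w" for s w
  proof (cases "s = 0")
    case False
    then obtain z where z: "z \<in> L" "s = (?E - total_energy z) / (mean_queue z - ?D)"
      using \<open>s \<in> S\<close> by (auto simp: S_def)
    have "(?E - total_energy z) * (?D - mean_queue w) \<le> (total_energy w - ?E) * (mean_queue z - ?D)"
      using cross[OF z(1) that(2-4)] by (simp add: algebra_simps)
    then show ?thesis using gap[OF z(1)] unfolding z(2) by (simp add: pos_divide_le_eq)
  qed (use that in simp)
  have bddS: "bdd_above S"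
  proof (rule bdd_aboveI)
    fix s assume "s \<in> S"
    then have "s * ?D \<le> mean_P - ?E" using bdd[of s ?greedy] greedy low by simp
    then show "s \<le> (mean_P - ?E) / ?D" using y by (simp add: pos_le_divide_eq)
  qed
  define \<kappa> where "\<kappa> = Sup S"
  have up: "s \<le> \<kappa>" if "s \<in> S" for s unfolding \<kappa>_def using that bddS by (rule cSup_upper)
  have "0 \<le> \<kappa>" using up[of 0] by (simp add: S_def)
  have "?E + \<kappa> * ?D \<le> total_energy z + \<kappa> * mean_queue z" if z: "admissible z" "finite_mean z" for z
  proof (cases "total_energy z < ?E")
    case True
    then have zL: "z \<in> L" using z by (simp add: L_def)
    then have "(?E - total_energy z) / (mean_queue z - ?D) \<le> \<kappa>" by (intro up) (simp add: S_def)
    then have "?E - total_energy z \<le> \<kappa> * (mean_queue z - ?D)"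
      using gap[OF zL] by (simp add: pos_divide_le_eq)
    then show ?thesis by (simp add: algebra_simps)
  next
    case False
    then have ge: "?E \<le> total_energy z" by simp
    show ?thesis
    proof (cases "?D \<le> mean_queue z")
      case True
      then have "\<kappa> * ?D \<le> \<kappa> * mean_queue z" using \<open>0 \<le> \<kappa>\<close> by (rule mult_left_mono)
      then show ?thesis using ge by simp
    next
      case False
      then have d: "0 < ?D - mean_queue z" by simp
      have "\<kappa> \<le> (total_energy z - ?E) / (?D - mean_queue z)"
        unfolding \<kappa>_def using bdd[OF _ z ge] d
        by (intro cSup_least) (auto simp: S_def pos_le_divide_eq)
      then have "\<kappa> * (?D - mean_queue z) \<le> total_energy z - ?E" using d by (simp add: pos_le_divide_eq)
      then show ?thesis by (simp add: algebra_simps)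
    qed
  qed
  moreover have "0 < \<kappa>" if "z \<in> L" for z
  proof -
    have "0 < (?E - total_energy z) / (mean_queue z - ?D)" using gap[OF that] that by (simp add: L_def)
    also have "\<dots> \<le> \<kappa>" using that by (intro up) (simp add: S_def)
    finally show ?thesis .
  qed
  ultimately show ?thesis using \<open>0 \<le> \<kappa>\<close> by (intro exI[of _ \<kappa>]) (auto simp: L_def)
qed

subsection \<open>An infinite buffer and minimal power\<close>

lemma mean_P_le_P_max: "mean_P \<le> P_max"
proof -
  have "mean_P \<le> (\<Sum>m = 1..M. \<eta> m * P_max)"
    unfolding mean_P_def using P_bounds(2) by (rule sum_used_mono)
  then show ?thesis using eta_sum by (simp flip: sum_distrib_right)
qed

lemma energy_excess: "energy y i - P_min * qp y i = (\<Sum>m = 1..M. \<eta> m * ((P m - P_min) * y i m))"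
  by (simp add: energy_def queue_prob_def sum_distrib_left sum_subtractf[symmetric] algebra_simps)

lemma energy_excess_nonneg:
  assumes "admissible y" shows "0 \<le> energy y i - P_min * qp y i"
proof -
  have "(\<Sum>m = 1..M. \<eta> m * 0) \<le> (\<Sum>m = 1..M. \<eta> m * ((P m - P_min) * y i m))"
    using P_bounds(1) admissibleD(1)[OF assms used_le_M] by (intro sum_used_mono) auto
  then show ?thesis unfolding energy_excess by simp
qed

lemma energy_excess_sums:
  assumes "admissible y"
  shows "(\<lambda>i. energy y i - P_min * qp y i) sums (total_energy y - P_min)"
  using sums_diff[OF energy_sums[OF assms] sums_mult[OF admissibleD(3)[OF assms], of P_min]] by simp

lemma P_min_le_total_energy:
  assumes "admissible y" shows "P_min \<le> total_energy y"
  using sums_le[OF energy_excess_nonneg[OF assms] sums_zero energy_excess_sums[OF assms]] by simp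

lemma mean_queue_nonneg: "admissible y \<Longrightarrow> finite_mean y \<Longrightarrow> 0 \<le> mean_queue y"
  unfolding mean_queue_def finite_mean_def using admissibleD(5) by (intro suminf_nonneg) auto

lemma avg_delay_le_iff:
  assumes "admissible y" "finite_mean y" "admissible z" "finite_mean z"
  shows "avg_delay M \<alpha> \<eta> Q y \<le> avg_delay M \<alpha> \<eta> Q z \<longleftrightarrow> mean_queue y \<le> mean_queue z"
  using assms alpha mean_queue_nonneg[of z] avg_delay_finite[of y] avg_delay_finite[of z]
  by (simp add: divide_le_cancel)

text \<open>With mean 0 all mass lies at level 0, where \<open>ub\<close> and \<open>qp\<close> are
  both 1. Then every channel of positive probability transmits fully, at energy
  \<open>mean_P\<close>.\<close>

lemma mean_queue_pos:
  assumes y: "admissible y" "finite_mean y" and low: "total_energy y < mean_P"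
  shows "0 < mean_queue y"
proof (rule ccontr)
  assume "\<not> 0 < mean_queue y"
  then have "(\<lambda>i. real i * qp y i) sums 0"
    using mean_queue_nonneg[OF y] finite_meanD[OF y(2)] by simp
  then have "(\<Sum>i. real i * qp y i) = 0" "summable (\<lambda>i. real i * qp y i)" by (auto simp: sums_iff)
  then have "real i * qp y i = 0" for i
    using admissibleD(5)[OF y(1)] by (subst (asm) suminf_eq_zero_iff) auto
  then have sup: "qp y i = 0" if "0 < i" for i using that by (metis mult_eq_0_iff of_nat_eq_0_iff less_irrefl)
  have "(\<Sum>i\<le>0. qp y i) = 1" by (rule bounded_support(4)[OF y(1) sup])
  then have ub: "ub y 0 = 1" and q: "qp y 0 = 1" using sup[of 1] by (auto simp: upper_bound_def)
  have "(\<Sum>m = 1..M. \<eta> m * (1 - y 0 m)) = 0"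
    using q eta_sum by (simp add: queue_prob_def sum_subtractf algebra_simps)
  then have "1 - y 0 m = 0" if "m \<in> used" for m
    using that admissibleD(2)[OF y(1) used_le_M, of _ 0] ub
    by (intro sum_used_eq_0[where f = "\<lambda>m. 1 - y 0 m"]) auto
  then have "(\<Sum>m = 1..M. \<eta> m * (P m * y 0 m)) = (\<Sum>m = 1..M. \<eta> m * P m)"
    by (intro sum_used_cong) auto
  then have "energy y 0 = mean_P" by (simp add: energy_def mean_P_def mult.assoc)
  moreover have "total_energy y = (\<Sum>i\<le>0. energy y i)" by (rule bounded_support(3)[OF y(1) sup])
  ultimately show False using low by simp
qed

text \<open>
  Forcing full transmission at a level \<open>n\<close> cuts off all higher levels and leaves the lower ones unchanged up to
  normalisation; the energy converges as \<open>n\<close> grows.  So strict feasibility never needs an infinite mean queue.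
\<close>

lemma truncation:
  assumes Q: "Q = \<infinity>" and z: "admissible z" and e: "total_energy z < e"
  shows "\<exists>w. admissible w \<and> finite_mean w \<and> total_energy w < e"
proof -
  define S where "S n = (\<Sum>i<Suc n. qp z i)" for n
  have qz: "qp z \<longlonglongrightarrow> 0"
    using admissibleD(3)[OF z] by (intro summable_LIMSEQ_zero) (simp add: sums_iff)
  have S1: "S \<longlonglongrightarrow> 1"
    unfolding S_def[abs_def] using admissibleD(3)[OF z] unfolding sums_def by (rule LIMSEQ_Suc)
  have E: "(\<lambda>n. \<Sum>i<n. energy z i) \<longlonglongrightarrow> total_energy z"
    using energy_sums[OF z] by (simp add: sums_def)
  have "(\<lambda>n. e * S n - ((\<Sum>i<n. energy z i) + mean_P * qp z n)) \<longlonglongrightarrow> e * 1 - (total_energy z + mean_P * 0)"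
    by (intro tendsto_intros S1 E qz)
  then have "\<forall>\<^sub>F n in sequentially. 0 < e * S n - ((\<Sum>i<n. energy z i) + mean_P * qp z n)"
    using e by (intro order_tendstoD(1)) auto
  moreover have "\<forall>\<^sub>F n in sequentially. 0 < S n" using S1 by (rule order_tendstoD(1)) simp
  ultimately have "\<forall>\<^sub>F n in sequentially. (\<Sum>i<n. energy z i) + mean_P * qp z n < e * S n \<and> 0 < S n"
    by eventually_elim simp
  then obtain n where n: "(\<Sum>i<n. energy z i) + mean_P * qp z n < e * S n" "0 < S n"
    by (auto simp: eventually_sequentially)
  \<comment> \<open>At level \<open>n\<close> every channel gets the value \<open>qp z n\<close>,
    which equals the new upper bound before normalisation and leaves \<open>qp\<close> unchanged
    there.\<close>
  define w where "w = (\<lambda>i m. (if i < n then z i m else if i = n then qp z n else 0) / S n)"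
  have qw: "qp w i = (if i \<le> n then qp z i else 0) / S n" for i
  proof -
    consider "i < n" | "i = n" | "i > n" by linarith
    then show ?thesis
      using eta_sum by cases (auto simp: w_def queue_prob_def sum_divide_distrib simp flip: sum_distrib_right)
  qed
  have ew: "energy w i = (if i < n then energy z i else if i = n then mean_P * qp z n else 0) / S n" for i
    by (auto simp: w_def energy_def mean_P_def sum_divide_distrib sum_distrib_right)
  have adm: "admissible w"
    unfolding admissible_def
  proof (intro conjI allI ballI impI)
    fix i m assume m: "m \<in> {1..M}"
    show "0 \<le> w i m"
      using n(2) admissibleD(1)[OF z m] admissibleD(5)[OF z] by (auto simp: w_def intro!: divide_nonneg_pos)
    consider "i < n" | "i = n" | "i > n" by linarith
    then show "w i m \<le> ub w i"
    proof cases
      case 1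
      then have "ub w i = ub z i / S n" by (simp add: upper_bound_def qw add_divide_distrib)
      then show ?thesis using 1 n(2) admissibleD(2)[OF z m, of i] by (simp add: w_def divide_right_mono)
    next
      case 2
      then have "ub w i = qp z i / S n" by (simp add: upper_bound_def qw)
      then show ?thesis using 2 by (simp add: w_def)
    next
      case 3
      then have "ub w i = 0" by (simp add: upper_bound_def qw)
      then show ?thesis using 3 by (simp add: w_def)
    qed
    show "w i m = 0" if "Q \<le> enat i" using that Q by simp
  next
    have "qp w sums (\<Sum>i<Suc n. qp w i)" by (intro sums_finite) (auto simp: qw)
    also have "(\<Sum>i<Suc n. qp w i) = (\<Sum>i<Suc n. qp z i / S n)" by (intro sum.cong) (auto simp: qw)
    also have "\<dots> = S n / S n" unfolding S_def by (rule sum_divide_distrib[symmetric])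
    also have "\<dots> = 1" using n(2) by simp
    finally show "qp w sums 1" .
  qed
  have sup: "qp w i = 0" if "n < i" for i using that by (simp add: qw)
  have "total_energy w = (\<Sum>i\<le>n. energy w i)" by (rule bounded_support(3)[OF adm sup])
  also have "\<dots> = (\<Sum>i<n. energy w i) + energy w n" by (simp flip: lessThan_Suc_atMost)
  also have "\<dots> = ((\<Sum>i<n. energy z i) + mean_P * qp z n) / S n"
    by (simp add: ew sum_divide_distrib add_divide_distrib)
  also have "\<dots> < e" using n by (simp add: pos_divide_less_eq)
  finally show ?thesis using adm bounded_support(1)[OF adm sup] by blast
qed

text \<open>The infinite buffer leaves room to move \<open>y\<close> up by one level. Mixing in some
  mass at the freed level \<open>k\<close>, served by a cheapest channel, gives an admissible point
  of smaller energy unless the energy is already \<open>P_min\<close>.\<close>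

lemma minimal_energy_eq_P_min:
  assumes Q: "Q = \<infinity>" and y: "admissible y"
    and min: "\<And>z. admissible z \<Longrightarrow> total_energy y \<le> total_energy z"
  shows "total_energy y = P_min"
proof (rule ccontr)
  assume "total_energy y \<noteq> P_min"
  then have E: "P_min < total_energy y" using P_min_le_total_energy[OF y] by simp
  obtain m1 where m1: "m1 \<in> used" "P m1 = P_min" using P_min_attained by blast
  then have eta: "0 < \<eta> m1" and m1M: "m1 \<in> {1..M}" by (auto simp: used_def)
  have "\<exists>i. qp y i \<noteq> 0"
  proof (rule ccontr)
    assume "\<nexists>i. qp y i \<noteq> 0"
    then have "qp y = (\<lambda>_. 0)" by auto
    then show False using admissibleD(3)[OF y] by (simp add: sums_iff)
  qed
  then obtain k where k: "qp y k \<noteq> 0" "\<And>i. i < k \<Longrightarrow> qp y i = 0"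
    using exists_least_iff[of "\<lambda>i. qp y i \<noteq> 0"] by auto
  have qk: "0 < qp y k" using k admissibleD(5)[OF y, of k] by simp
  define a where "a = \<eta> m1 * \<xi> * qp y k"
  have a: "0 < a" using eta xi_pos qk by (simp add: a_def)
  \<comment> \<open>The solution of \<open>e = (1 - e) * a\<close>. It makes the value
    \<open>e / \<eta> m1\<close> of the inserted channel equal to the part
    \<open>(1 - e) * \<xi> * qp y k\<close> of its upper bound that comes from the level
    above.\<close>
  define e where "e = a / (1 + a)"
  have e: "0 < e" "e < 1" "e = (1 - e) * a" using a by (auto simp: e_def field_simps)
  define s where "s i m = (case i of 0 \<Rightarrow> 0 | Suc j \<Rightarrow> y j m)" for i m
  define d where "d i m = (if i = k \<and> m = m1 then 1 / \<eta> m1 else 0)" for i m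
  have qs: "qp s 0 = 0" "qp s (Suc j) = qp y j" for j by (auto simp: s_def queue_prob_def)
  have es: "energy s 0 = 0" "energy s (Suc j) = energy y j" for j by (auto simp: s_def energy_def)
  have qd: "qp d i = (if i = k then 1 else 0)" for i
  proof -
    have "qp d i = (\<Sum>m = 1..M. if m = m1 then (if i = k then 1 else 0) else 0)"
      unfolding queue_prob_def d_def using eta by (intro sum.cong) auto
    then show ?thesis using m1M by (simp add: sum.delta')
  qed
  have ed: "energy d i = (if i = k then P_min else 0)" for i
  proof -
    have "energy d i = (\<Sum>m = 1..M. if m = m1 then (if i = k then P_min else 0) else 0)"
      unfolding energy_def d_def using eta m1 by (intro sum.cong) auto
    then show ?thesis using m1M by (simp add: sum.delta')
  qed
  define z where "z = (\<lambda>i m. (1 - e) * s i m + e * d i m)"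
  have s_le: "0 \<le> s i m" "s i m \<le> ub s i" if m: "m \<in> {1..M}" for i m
    using admissibleD(1)[OF y m] admissibleD(2)[OF y m] admissibleD(5)[OF y] xi_pos qs
    by (cases i; simp add: s_def upper_bound_def)+
  have d_nonneg: "0 \<le> d i m" for i m using eta by (simp add: d_def)
  have ubd: "0 \<le> ub d i" for i using xi_pos by (simp add: upper_bound_def qd)
  have adm: "admissible z"
    unfolding admissible_def
  proof (intro conjI allI ballI impI)
    fix i m assume m: "m \<in> {1..M}"
    show "0 \<le> z i m" using s_le(1)[OF m] d_nonneg e by (simp add: z_def)
    have ubz: "ub z i = (1 - e) * ub s i + e * ub d i" unfolding z_def by (rule ub_lincomb)
    show "z i m \<le> ub z i"
    proof (cases "i = k \<and> m = m1")
      case True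
      \<comment> \<open>Level \<open>k\<close> is the first occupied one of \<open>y\<close>, so
        after the shift it is empty.\<close>
      have "s k m1 = 0"
      proof (cases k)
        case (Suc j)
        then have "(\<Sum>m = 1..M. \<eta> m * y j m) = 0" using k(2)[of j] by (simp add: queue_prob_def)
        then have "y j m1 = 0"
          using m1(1) admissibleD(1)[OF y used_le_M] by (intro sum_used_eq_0[of "y j"]) auto
        then show ?thesis using Suc by (simp add: s_def)
      qed (simp add: s_def)
      then have "z i m = e / \<eta> m1" using True by (simp add: z_def d_def)
      also have "\<dots> = (1 - e) * a / \<eta> m1" using e(3) by simp
      also have "\<dots> = (1 - e) * (\<xi> * qp s (Suc k))" using eta by (simp add: a_def qs)
      also have "\<dots> \<le> (1 - e) * ub s k"
        using e admissibleD(5)[OF y] qs by (cases k) (auto simp: upper_bound_def intro!: mult_left_mono)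
      also have "\<dots> \<le> ub z i" using ubz True ubd[of k] e by simp
      finally show ?thesis .
    next
      case False
      then have "z i m = (1 - e) * s i m" by (auto simp: z_def d_def)
      also have "\<dots> \<le> (1 - e) * ub s i" using s_le(2)[OF m] e by (intro mult_left_mono) auto
      also have "\<dots> \<le> ub z i" using ubz ubd[of i] e by simp
      finally show ?thesis .
    qed
    show "z i m = 0" if "Q \<le> enat i" using that Q by simp
  next
    have "qp s sums 1" using sums_Suc[of "qp s" 1] admissibleD(3)[OF y] by (simp add: qs)
    moreover have "qp d sums 1" using sums_single[of k "\<lambda>_. 1::real"] by (simp add: qd[abs_def])
    ultimately have "(\<lambda>i. (1 - e) * qp s i + e * qp d i) sums ((1 - e) * 1 + e * 1)"
      by (intro sums_add sums_mult)
    then show "qp z sums 1" unfolding z_def qp_lincomb[abs_def] by simp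
  qed
  have "energy s sums total_energy y" using sums_Suc[of "energy s"] energy_sums[OF y] by (simp add: es)
  moreover have "energy d sums P_min" using sums_single[of k "\<lambda>_. P_min"] by (simp add: ed[abs_def])
  ultimately have "(\<lambda>i. (1 - e) * energy s i + e * energy d i) sums ((1 - e) * total_energy y + e * P_min)"
    by (intro sums_add sums_mult)
  then have "energy z sums ((1 - e) * total_energy y + e * P_min)"
    unfolding z_def energy_lincomb[abs_def] .
  then have "total_energy z = (1 - e) * total_energy y + e * P_min" by (simp add: total_energy_def sums_iff)
  also have "\<dots> < (1 - e) * total_energy y + e * total_energy y" using e E by simp
  finally show False using min[OF adm] by (simp add: algebra_simps)
qed

text \<open>Points of energy \<open>P_min\<close> use cheapest channels only, which forces
  \<open>qp w (Suc i)\<close> to be at least \<open>r * qp w i\<close>. The policy that always uses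
  all these channels attains equality: its queue length is geometric with ratio
  \<open>r\<close>.\<close>

lemma minimal_energy_threshold:
  assumes Q: "Q = \<infinity>" and y: "admissible y"
    and min: "\<And>z. admissible z \<Longrightarrow> total_energy y \<le> total_energy z"
    and low: "total_energy y < mean_P"
  shows "\<exists>z thr. admissible z \<and> total_energy z = total_energy y \<and>
    threshold_structure M \<alpha> \<eta> Q thr z \<and>
    (\<forall>w. admissible w \<and> total_energy w \<le> total_energy y \<longrightarrow> avg_delay M \<alpha> \<eta> Q z \<le> avg_delay M \<alpha> \<eta> Q w)"
proof -
  have E: "total_energy y = P_min" by (rule minimal_energy_eq_P_min[OF Q y min])
  \<comment> \<open>Channels of probability 0 with power below \<open>P_min\<close> are included, so
    that channel 1 is always cheap and gets threshold 0.\<close>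
  define cheap where "cheap m \<longleftrightarrow> P m \<le> P_min" for m
  define c where "c = (\<Sum>m = 1..M. \<eta> m * (if cheap m then 1 else 0))"
  obtain m0 where m0: "m0 \<in> used" "P m0 = P_min" using P_min_attained by blast
  have "(\<Sum>m = 1..M. \<eta> m * 0) < c"
    unfolding c_def using m0 by (intro sum_used_strict_mono[of _ _ m0]) (auto simp: cheap_def)
  then have c0: "0 < c" by simp
  have "c \<le> (\<Sum>m = 1..M. \<eta> m * 1)" unfolding c_def by (intro sum_used_mono) auto
  then have c1: "c \<le> 1" using eta_sum by simp
  define r where "r = (1 - c) / (c * \<xi>)"
  have r0: "0 \<le> r" using c0 c1 xi_pos by (simp add: r_def)
  have cr: "c * \<xi> * r = 1 - c" using c0 xi_pos by (simp add: r_def)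
  have growth: "r * qp w i \<le> qp w (Suc i)"
    if w: "admissible w" "total_energy w \<le> total_energy y" for w i
  proof -
    have "total_energy w = P_min" using w(2) E P_min_le_total_energy[OF w(1)] by simp
    then have "(\<lambda>i. energy w i - P_min * qp w i) sums 0" using energy_excess_sums[OF w(1)] by simp
    then have "(\<Sum>i. energy w i - P_min * qp w i) = 0" "summable (\<lambda>i. energy w i - P_min * qp w i)"
      by (auto simp: sums_iff)
    then have "energy w i - P_min * qp w i = 0"
      using energy_excess_nonneg[OF w(1)] by (subst (asm) suminf_eq_zero_iff) auto
    then have z: "(P m - P_min) * w i m = 0" if "m \<in> used" for m
      unfolding energy_excess using that P_bounds(1) admissibleD(1)[OF w(1) used_le_M]
      by (intro sum_used_eq_0[where f = "\<lambda>m. (P m - P_min) * w i m"]) auto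
    have "qp w i \<le> (\<Sum>m = 1..M. \<eta> m * (if cheap m then ub w i else 0))"
      unfolding queue_prob_def
    proof (rule sum_used_mono)
      fix m assume m: "m \<in> used"
      show "w i m \<le> (if cheap m then ub w i else 0)"
        using z[OF m] admissibleD(2)[OF w(1) used_le_M[OF m], of i] by (auto simp: cheap_def)
    qed
    also have "\<dots> = c * ub w i" unfolding c_def sum_distrib_right by (intro sum.cong) auto
    finally have "(1 - c) * qp w i \<le> c * \<xi> * qp w (Suc i)" by (simp add: upper_bound_def algebra_simps)
    then have "(c * \<xi>) * (r * qp w i) \<le> (c * \<xi>) * qp w (Suc i)" by (simp flip: cr add: mult.assoc)
    then show ?thesis using c0 xi_pos by simp
  qed
  \<comment> \<open>Otherwise the distribution of \<open>y\<close> would be nondecreasing, which a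
    summable nonzero sequence of nonnegative terms cannot be.\<close>
  have r1: "r < 1"
  proof (rule ccontr)
    assume "\<not> r < 1"
    then have "qp y i \<le> qp y (Suc i)" for i
      using growth[OF y, of i] mult_right_mono[of 1 r "qp y i"] admissibleD(5)[OF y, of i] by simp
    then have "incseq (qp y)" by (rule incseq_SucI)
    moreover have "qp y \<longlonglongrightarrow> 0"
      using admissibleD(3)[OF y] by (intro summable_LIMSEQ_zero) (simp add: sums_iff)
    ultimately have "qp y i \<le> 0" for i by (rule incseq_le)
    then have "qp y = (\<lambda>_. 0)" using admissibleD(5)[OF y] by (auto simp: fun_eq_iff intro: antisym)
    then show False using admissibleD(3)[OF y] by (simp add: sums_iff)
  qed
  define g where "g i = (1 - r) * r ^ i" for i
  define z where "z i m = (if cheap m then g i + \<xi> * g (Suc i) else 0)" for i m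
  have qz: "qp z i = g i" for i
  proof -
    have "qp z i = c * (g i + \<xi> * g (Suc i))"
      unfolding queue_prob_def z_def c_def sum_distrib_right by (intro sum.cong) auto
    also have "\<dots> = (c + c * \<xi> * r) * g i" by (simp add: g_def algebra_simps)
    finally show ?thesis unfolding cr by simp
  qed
  have g0: "0 \<le> g i" for i using r0 r1 by (simp add: g_def)
  have ubz: "ub z i = g i + \<xi> * g (Suc i)" for i by (simp add: upper_bound_def qz)
  have zub: "z i m = (if cheap m then ub z i else 0)" for i m by (simp add: ubz z_def)
  have g_sums: "g sums 1"
    using sums_mult[OF geometric_sums[of r], of "1 - r"] r0 r1 by (simp add: g_def[abs_def])
  have adm: "admissible z"
    unfolding admissible_def using g0 xi_pos Q g_sums by (auto simp: zub ubz qz[abs_def])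
  have "(\<Sum>m = 1..M. \<eta> m * ((P m - P_min) * z i m)) = (\<Sum>m = 1..M. \<eta> m * 0)" for i
    using P_bounds(1) by (intro sum_used_cong) (force simp: z_def cheap_def)
  then have "energy z = (\<lambda>i. P_min * g i)" using energy_excess[of z] by (simp add: qz fun_eq_iff)
  then have "energy z sums (P_min * 1)" using sums_mult[OF g_sums, of P_min] by simp
  then have Ez: "total_energy z = total_energy y" unfolding E by (simp add: total_energy_def sums_iff)
  have "(\<lambda>i. (1 - r) * (real (Suc i) * r ^ i)) sums ((1 - r) * (1 / (1 - r)\<^sup>2))"
    using r0 r1 by (intro sums_mult geometric_deriv_sums) simp
  from sums_diff[OF this g_sums]
  have "(\<lambda>i. real i * g i) sums ((1 - r) * (1 / (1 - r)\<^sup>2) - 1)" by (simp add: g_def algebra_simps)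
  also have "(1 - r) * (1 / (1 - r)\<^sup>2) - 1 = r / (1 - r)"
    using r1 by (simp add: power2_eq_square divide_simps)
  finally have Dz: "finite_mean z" "mean_queue z = r / (1 - r)"
    by (auto simp: finite_mean_def mean_queue_def qz sums_iff)
  have delay: "avg_delay M \<alpha> \<eta> Q z \<le> avg_delay M \<alpha> \<eta> Q w"
    if w: "admissible w" "total_energy w \<le> total_energy y" for w
  proof (cases "finite_mean w")
    case True
    have D: "(\<lambda>i. real i * qp w i) sums mean_queue w" by (rule finite_meanD[OF True])
    have "(\<lambda>i. r * (real i * qp w i + qp w i)) sums (r * (mean_queue w + 1))"
      by (intro sums_mult sums_add D admissibleD(3)[OF w(1)])
    moreover have "(\<lambda>i. real (Suc i) * qp w (Suc i)) sums mean_queue w"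
      using D by (subst sums_Suc_iff) simp
    moreover have "r * (real i * qp w i + qp w i) \<le> real (Suc i) * qp w (Suc i)" for i
      using mult_left_mono[OF growth[OF w, of i], of "real (Suc i)"] by (simp add: algebra_simps)
    \<comment> \<open>Multiplying the growth bound by \<open>i + 1\<close> and summing turns it into
      a bound on the mean, with equality for the geometric distribution.\<close>
    ultimately have "r * (mean_queue w + 1) \<le> mean_queue w" by (rule sums_le[rotated])
    then have "r \<le> mean_queue w * (1 - r)" by (simp add: algebra_simps)
    then have "mean_queue z \<le> mean_queue w" using r1 by (simp add: Dz pos_divide_le_eq)
    then show ?thesis using avg_delay_le_iff[OF adm Dz(1) w(1) True] by simp
  next
    case False then show ?thesis using avg_delay_infinite[OF w(1)] by simp
  qed
  have "P_min < P_max" using low E mean_P_le_P_max by simp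
  then have "M \<ge> 2" by (rule M_ge_2)
  define thr where "thr m = (if cheap m then 0 else \<infinity> :: enat)" for m
  have "mono_on {1..M} thr"
  proof (rule mono_onI)
    fix m m' assume "m \<in> {1..M}" "m' \<in> {1..M}" "m \<le> m'"
    then have "P m \<le> P m'" using mono_onD[OF P_mono] by blast
    then show "thr m \<le> thr m'" by (auto simp: thr_def cheap_def)
  qed
  then have "threshold_structure M \<alpha> \<eta> Q thr z"
    using P_1_le \<open>M \<ge> 2\<close> Q by (auto simp: threshold_structure_def thr_def zub cheap_def zero_enat_def)
  then show ?thesis using adm Ez delay by blast
qed

text \<open>Infinite thresholds come only from the case of an infinite buffer and minimal power;
  every feasible point then uses the full power, which the last conjunct records.\<close>

lemma optimal_threshold:
  assumes y: "lp_optimal M \<alpha> \<eta> P Q pmax y" and tight: "avg_power M \<alpha> \<eta> P Q y = pmax"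
    and low: "pmax < power_threshold M \<alpha> \<eta> P"
  shows "\<exists>y thr. lp_optimal M \<alpha> \<eta> P Q pmax y \<and> avg_power M \<alpha> \<eta> P Q y = pmax \<and>
           threshold_structure M \<alpha> \<eta> Q thr y \<and>
           ((\<exists>m\<in>{1..M}. thr m = \<infinity>) \<longrightarrow>
              (\<forall>z. lp_feasible M \<alpha> \<eta> P Q pmax z \<longrightarrow> avg_power M \<alpha> \<eta> P Q z = pmax))"
proof -
  have adm: "admissible y" using y by (simp add: lp_optimal_def lp_feasible_iff)
  have E: "\<alpha> * total_energy y = pmax" using tight avg_power_eq[OF adm] by simp
  have feas: "lp_feasible M \<alpha> \<eta> P Q pmax z \<longleftrightarrow> admissible z \<and> total_energy z \<le> total_energy y" for z
    unfolding lp_feasible_iff E[symmetric] using alpha by simp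
  have opt: "avg_delay M \<alpha> \<eta> Q y \<le> avg_delay M \<alpha> \<eta> Q z"
    if "admissible z" "total_energy z \<le> total_energy y" for z
    using y that by (simp add: lp_optimal_def feas)
  have low': "total_energy y < mean_P"
    using low alpha unfolding E[symmetric] power_threshold_def mean_P_def by simp
  have P: "P_min < P_max" using low' P_min_le_total_energy[OF adm] mean_P_le_P_max by simp
  show ?thesis
  proof (cases "Q = \<infinity> \<and> (\<forall>z. admissible z \<longrightarrow> total_energy y \<le> total_energy z)")
    case True
    then obtain z thr where z: "admissible z" "total_energy z = total_energy y"
        "threshold_structure M \<alpha> \<eta> Q thr z"
        "\<And>w. admissible w \<Longrightarrow> total_energy w \<le> total_energy y \<Longrightarrow> avg_delay M \<alpha> \<eta> Q z \<le> avg_delay M \<alpha> \<eta> Q w"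
      using minimal_energy_threshold[OF _ adm _ low'] by blast
    have "lp_optimal M \<alpha> \<eta> P Q pmax z" using z by (auto simp: lp_optimal_def feas)
    moreover have "avg_power M \<alpha> \<eta> P Q z = pmax" using avg_power_eq[OF z(1)] z(2) E by simp
    moreover have "avg_power M \<alpha> \<eta> P Q w = pmax" if "lp_feasible M \<alpha> \<eta> P Q pmax w" for w
    proof -
      have w: "admissible w" "total_energy w \<le> total_energy y" using that feas by auto
      then have "total_energy w = total_energy y" using True by (intro antisym) auto
      then show ?thesis using avg_power_eq[OF w(1)] E by simp
    qed
    ultimately show ?thesis using z(3) by blast
  next
    case False
    \<comment> \<open>For an infinite buffer some point needs strictly less power, by
      \<open>truncation\<close> even with a finite mean queue. This makes the optimal delay finite
      and the multiplier positive.\<close>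
    have slater: "\<exists>w. admissible w \<and> finite_mean w \<and> total_energy w < total_energy y" if "Q = \<infinity>"
      using False that truncation by (metis not_le)
    have fin: "finite_mean y"
    proof (cases Q)
      case (enat q)
      have "qp y i = 0" if "q < i" for i using admissibleD(6)[OF adm, of i] enat that by simp
      then show ?thesis by (rule bounded_support(1)[OF adm])
    next
      case infinity
      then obtain w where w: "admissible w" "finite_mean w" "total_energy w < total_energy y"
        using slater by blast
      then have "avg_delay M \<alpha> \<eta> Q y < \<infinity>"
        using opt[of w] avg_delay_finite[OF w(1,2)] by (simp add: order_le_less_trans[OF _ ennreal_less_top])
      then show ?thesis using avg_delay_infinite[OF adm] by (cases "finite_mean y") auto
    qed
    have "mean_queue y \<le> mean_queue z"
      if "admissible z" "finite_mean z" "total_energy z \<le> total_energy y" for z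
      using opt[OF that(1,3)] avg_delay_le_iff[OF adm fin that(1,2)] by simp
    then obtain \<kappa> where k: "0 \<le> \<kappa>"
      "\<And>z. admissible z \<Longrightarrow> finite_mean z \<Longrightarrow>
        total_energy y + \<kappa> * mean_queue y \<le> total_energy z + \<kappa> * mean_queue z"
      "(\<exists>z. admissible z \<and> finite_mean z \<and> total_energy z < total_energy y) \<longrightarrow> 0 < \<kappa>"
      using multiplier_exists[OF adm fin mean_queue_pos[OF adm fin low'] low'] by blast
    have "Q = \<infinity> \<Longrightarrow> 0 < \<kappa>" using k(3) slater by blast
    then obtain z thr where z: "admissible z" "finite_mean z" "mean_queue z = mean_queue y"
      "total_energy z = total_energy y" "threshold_structure M \<alpha> \<eta> Q thr z" "\<And>m. thr m \<noteq> \<infinity>"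
      using lagrangian_minimiser_threshold[OF adm fin k(1) _ P k(2)] by blast
    have "avg_delay M \<alpha> \<eta> Q z = avg_delay M \<alpha> \<eta> Q y"
      using avg_delay_finite[OF z(1,2)] avg_delay_finite[OF adm fin] z(3) by simp
    then have "lp_optimal M \<alpha> \<eta> P Q pmax z" using z(1,4) opt by (simp add: lp_optimal_def feas)
    moreover have "avg_power M \<alpha> \<eta> P Q z = pmax" using avg_power_eq[OF z(1)] z(4) E by simp
    ultimately show ?thesis using z(5,6) by blast
  qed
qed

end

theorem theorem2:
  fixes M :: nat and \<alpha> :: real and \<eta> P :: "nat \<Rightarrow> real" and Q :: enat and pmax :: real
  assumes "M \<ge> 1"
    and "0 < \<alpha>" and "\<alpha> < 1"
    and "\<And>m. m \<in> {1..M} \<Longrightarrow> 0 \<le> \<eta> m" and "(\<Sum>m = 1..M. \<eta> m) = 1"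
    and "mono_on {1..M} P"
    and "Q > 0"
    and "\<exists>y. lp_optimal M \<alpha> \<eta> P Q pmax y \<and> avg_power M \<alpha> \<eta> P Q y = pmax"
    and "pmax < power_threshold M \<alpha> \<eta> P"
  shows "\<exists>y thr. lp_optimal M \<alpha> \<eta> P Q pmax y \<and> avg_power M \<alpha> \<eta> P Q y = pmax \<and>
           threshold_structure M \<alpha> \<eta> Q thr y \<and>
           ((\<exists>m\<in>{1..M}. thr m = \<infinity>) \<longrightarrow>
              (\<forall>z. lp_feasible M \<alpha> \<eta> P Q pmax z \<longrightarrow> avg_power M \<alpha> \<eta> P Q z = pmax))"
proof -
  interpret queue_model M \<alpha> \<eta> P Q using assms by unfold_locales auto
  show ?thesis using assms(8,9) optimal_threshold by blast
qed

end
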